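(* Let $a>0$, $b>0$. The operator $\mathbb{W}_1^{a,b}$ is a distance on the space $\mathcal{M}^s(\mathbb{R}^d)$ of signed measures with finite mass on $\mathbb{R}^d$.
   Context: $\mathcal{M}(\mathbb{R}^d)$ is the set of positive Borel (Radon) measures on $\mathbb{R}^d$ with finite mass; $\mathcal{M}^s(\mathbb{R}^d)$ is the vector space of signed measures $\mu=\mu_+-\mu_-$ with $\mu_\pm\in\mathcal{M}(\mathbb{R}^d)$; $|\mu|$ denotes the total mass (total variation) of $\mu$. For $\tilde\mu,\tilde\nu\in\mathcal{M}(\mathbb{R}^d)$ of equal mass, $W_1(\tilde\mu,\tilde\nu)=\min_{\pi}\int|x-y|\,d\pi(x,y)$ over positive measures $\pi$ on $\mathbb{R}^d\times\mathbb{R}^d$ with marginals $\tilde\mu,\tilde\nu$. For $\mu,\nu\in\mathcal{M}(\mathbb{R}^d)$, $$W_1^{a,b}(\mu,\nu)=\inf\{a(|\mu-\tilde\mu|+|\nu-\tilde\nu|)+bW_1(\tilde\mu,\tilde\nu):\ \tilde\mu,\tilde\nu\in\mathcal{M}(\mathbb{R}^d),\ |\tilde\mu|=|\tilde\nu|\}.$$ For $\mu,\nu\in\mathcal{M}^s(\mathbb{R}^d)$, $\mathbb{W}_1^{a,b}(\mu,\nu)=W_1^{a,b}(\mu_++\nu_-,\mu_-+\nu_+)$, where $\mu_+,\mu_-,\nu_+,\nu_-$ are any measures in $\mathcal{M}(\mathbb{R}^d)$ such that $\mu=\mu_+-\mu_-$ and $\nu=\nu_+-\nu_-$. *)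

theory Defs
  imports "HOL-Analysis.Analysis"
begin

text \<open>
  Throughout, \<open>'a :: euclidean_space\<close> plays the role of \<open>\<real>\<^sup>d\<close>. Every finite Borel measure on it
  is a Radon measure, so regularity is not required separately.
\<close>

definition finite_borel_measures :: "'a::euclidean_space measure set" where
  "finite_borel_measures = {\<mu>. sets \<mu> = sets borel \<and> finite_measure \<mu>}"

definition add_measure :: "'a::euclidean_space measure \<Rightarrow> 'a measure \<Rightarrow> 'a measure" where
  "add_measure \<mu> \<nu> = measure_of UNIV (sets borel) (\<lambda>A. emeasure \<mu> A + emeasure \<nu> A)"

text \<open>
  A signed measure is a real-valued set function. It vanishes off the Borel sets, because
  \<^const>\<open>measure\<close> does, so two signed measures are equal as functions exactly when they agree
  on all Borel sets.
\<close>

definition diff_measure :: "'a::euclidean_space measure \<Rightarrow> 'a measure \<Rightarrow> 'a set \<Rightarrow> real" where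
  "diff_measure \<mu> \<nu> = (\<lambda>A. measure \<mu> A - measure \<nu> A)"

definition signed_measures :: "('a::euclidean_space set \<Rightarrow> real) set" where
  "signed_measures =
     {diff_measure P N | P N. P \<in> finite_borel_measures \<and> N \<in> finite_borel_measures}"

definition decomposes :: "'a::euclidean_space measure \<Rightarrow> 'a measure \<Rightarrow> ('a set \<Rightarrow> real) \<Rightarrow> bool" where
  "decomposes P N \<mu> \<longleftrightarrow>
     P \<in> finite_borel_measures \<and> N \<in> finite_borel_measures \<and> \<mu> = diff_measure P N"

definition total_variation :: "('a::euclidean_space set \<Rightarrow> real) \<Rightarrow> ennreal" where
  "total_variation \<mu> =
     (SUP \<P> \<in> {\<P>. finite \<P> \<and> partition_on UNIV \<P> \<and> \<P> \<subseteq> sets borel}. \<Sum>A\<in>\<P>. ennreal \<bar>\<mu> A\<bar>)"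

definition couplings ::
  "'a::euclidean_space measure \<Rightarrow> 'a measure \<Rightarrow> ('a \<times> 'a) measure set" where
  "couplings \<mu> \<nu> = {\<pi>. sets \<pi> = sets borel \<and> distr \<pi> borel fst = \<mu> \<and> distr \<pi> borel snd = \<nu>}"

text \<open>
  The Wasserstein cost may be infinite, since no finite first moments are assumed; hence it takes
  values in \<^typ>\<open>ennreal\<close>.
\<close>

definition W1 :: "'a::euclidean_space measure \<Rightarrow> 'a measure \<Rightarrow> ennreal" where
  "W1 \<mu> \<nu> = (INF \<pi> \<in> couplings \<mu> \<nu>. \<integral>\<^sup>+ (x, y). ennreal (norm (x - y)) \<partial>\<pi>)"

definition gen_W1 ::
  "real \<Rightarrow> real \<Rightarrow> 'a::euclidean_space measure \<Rightarrow> 'a measure \<Rightarrow> ennreal" where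
  "gen_W1 a b \<mu> \<nu> =
     (INF (\<mu>', \<nu>') \<in> {(\<mu>', \<nu>'). \<mu>' \<in> finite_borel_measures \<and> \<nu>' \<in> finite_borel_measures \<and>
                                   emeasure \<mu>' UNIV = emeasure \<nu>' UNIV}.
        ennreal a * (total_variation (diff_measure \<mu> \<mu>') + total_variation (diff_measure \<nu> \<nu>'))
          + ennreal b * W1 \<mu>' \<nu>')"

text \<open>
  The common value of \<open>gen_W1\<close> over all decompositions of the two signed measures.
  If that value depended on the decompositions, the definite description would be unspecified;
  independence is thus part of what has to be shown about \<open>signed_W1\<close>.
  The conversion to \<^typ>\<open>real\<close> loses nothing, by \<open>gen_W1_finite\<close> below.
\<close>

definition signed_W1 ::
  "real \<Rightarrow> real \<Rightarrow> ('a::euclidean_space set \<Rightarrow> real) \<Rightarrow> ('a set \<Rightarrow> real) \<Rightarrow> real" where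
  "signed_W1 a b \<mu> \<nu> =
     enn2real (THE r. \<forall>\<mu>\<^sub>P \<mu>\<^sub>N \<nu>\<^sub>P \<nu>\<^sub>N.
       decomposes \<mu>\<^sub>P \<mu>\<^sub>N \<mu> \<longrightarrow> decomposes \<nu>\<^sub>P \<nu>\<^sub>N \<nu> \<longrightarrow>
       r = gen_W1 a b (add_measure \<mu>\<^sub>P \<nu>\<^sub>N) (add_measure \<mu>\<^sub>N \<nu>\<^sub>P))"

lemma sets_add_measure [simp]: "sets (add_measure \<mu> \<nu>) = sets borel"
  unfolding add_measure_def by (metis sets.sets_measure_of_eq space_borel)

lemma emeasure_add_measure:
  assumes "sets \<mu> = sets borel" "sets \<nu> = sets borel" "A \<in> sets borel"
  shows "emeasure (add_measure \<mu> \<nu>) A = emeasure \<mu> A + emeasure \<nu> A"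
proof (rule emeasure_measure_of[OF add_measure_def])
  show "sets borel \<subseteq> Pow UNIV" by simp
  show "A \<in> sets (add_measure \<mu> \<nu>)" using assms by simp
  show "positive (sets (add_measure \<mu> \<nu>)) (\<lambda>A. emeasure \<mu> A + emeasure \<nu> A)"
    by (simp add: positive_def)
  show "countably_additive (sets (add_measure \<mu> \<nu>)) (\<lambda>A. emeasure \<mu> A + emeasure \<nu> A)"
    using assms by (auto simp: countably_additive_def suminf_add[symmetric] suminf_emeasure)
qed

lemma add_measure_finite:
  assumes "\<mu> \<in> finite_borel_measures" "\<nu> \<in> finite_borel_measures"
  shows "add_measure \<mu> \<nu> \<in> finite_borel_measures"
proof -
  have s: "sets \<mu> = sets borel" "sets \<nu> = sets borel" and f: "finite_measure \<mu>" "finite_measure \<nu>"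
    using assms by (auto simp: finite_borel_measures_def)
  have "space (add_measure \<mu> \<nu>) = UNIV"
    using sets_eq_imp_space_eq[OF sets_add_measure] by simp
  then show ?thesis
    unfolding finite_borel_measures_def
    using emeasure_add_measure[OF s, of UNIV] f
    by (auto intro!: finite_measureI simp: finite_measure.emeasure_finite)
qed

lemma total_variation_measure:
  assumes "\<mu> \<in> finite_borel_measures"
  shows "total_variation (measure \<mu>) = emeasure \<mu> UNIV"
proof -
  have s: "sets \<mu> = sets borel" and f: "finite_measure \<mu>"
    using assms by (auto simp: finite_borel_measures_def)
  let ?S = "{\<P>. finite \<P> \<and> partition_on UNIV \<P> \<and> \<P> \<subseteq> sets borel}"
  have eq: "(\<Sum>A\<in>\<P>. ennreal \<bar>measure \<mu> A\<bar>) = emeasure \<mu> UNIV" if "\<P> \<in> ?S" for \<P>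
  proof -
    have "(\<Sum>A\<in>\<P>. ennreal \<bar>measure \<mu> A\<bar>) = (\<Sum>A\<in>\<P>. emeasure \<mu> A)"
      by (simp add: finite_measure.emeasure_eq_measure[OF f])
    also have "\<dots> = emeasure \<mu> (\<Union>A\<in>\<P>. A)"
      using that s by (intro sum_emeasure) (auto simp: partition_on_def disjoint_family_on_disjoint_image
          disjoint_def disjoint_family_on_def)
    also have "(\<Union>A\<in>\<P>. A) = UNIV"
      using that by (simp add: partition_on_def)
    finally show ?thesis .
  qed
  have "{UNIV} \<in> ?S" by (simp add: partition_on_def)
  then have "?S \<noteq> {}" by blast
  then have "(SUP \<P>\<in>?S. \<Sum>A\<in>\<P>. ennreal \<bar>measure \<mu> A\<bar>) = emeasure \<mu> UNIV"
    using eq by (rule SUP_eq_const)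
  then show ?thesis
    unfolding total_variation_def .
qed

lemma gen_W1_finite:
  fixes \<mu> \<nu> :: "'a::euclidean_space measure"
  assumes "\<mu> \<in> finite_borel_measures" "\<nu> \<in> finite_borel_measures"
  shows "gen_W1 a b \<mu> \<nu> < \<infinity>"
proof -
  let ?Z = "null_measure borel :: 'a measure"
  let ?Z2 = "null_measure borel :: ('a \<times> 'a) measure"
  have Z: "?Z \<in> finite_borel_measures"
    by (auto simp: finite_borel_measures_def intro!: finite_measureI)
  have f: "finite_measure \<mu>" "finite_measure \<nu>"
    using assms by (auto simp: finite_borel_measures_def)
  have m: "(fst :: 'a \<times> 'a \<Rightarrow> 'a) \<in> ?Z2 \<rightarrow>\<^sub>M borel" "(snd :: 'a \<times> 'a \<Rightarrow> 'a) \<in> ?Z2 \<rightarrow>\<^sub>M borel"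
    by (auto simp: measurable_cong_sets[of ?Z2 borel borel borel]
        intro!: borel_measurable_continuous_onI continuous_intros)
  have "?Z2 \<in> couplings ?Z ?Z"
    using m by (auto simp: couplings_def emeasure_distr intro!: measure_eqI)
  then have "W1 ?Z ?Z \<le> (\<integral>\<^sup>+ (x, y). ennreal (norm (x - y)) \<partial>?Z2)"
    unfolding W1_def by (rule INF_lower)
  also have "\<dots> = 0" by simp
  finally have W: "W1 ?Z ?Z = 0" by simp
  have d: "diff_measure \<eta> ?Z = measure \<eta>" for \<eta>
    by (auto simp: diff_measure_def fun_eq_iff)
  have "gen_W1 a b \<mu> \<nu> \<le> ennreal a * (total_variation (diff_measure \<mu> ?Z)
      + total_variation (diff_measure \<nu> ?Z)) + ennreal b * W1 ?Z ?Z"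
    unfolding gen_W1_def by (rule INF_lower2[of "(?Z, ?Z)"]) (auto simp: Z)
  also have "\<dots> < \<infinity>"
    using f[THEN finite_measure.emeasure_finite, of UNIV]
    by (simp add: W d total_variation_measure assms ennreal_mult_less_top top.not_eq_extremum)
  finally show ?thesis .
qed

end

(*
Everything rests on Kantorovich-Rubinstein duality for the generalised distance: gen_W1 a b mu nu is
the supremum of int phi dmu - int phi dnu over all b-Lipschitz phi with values in [-a, a].
The bound from below follows from the Hahn decomposition and from integrating phi against a coupling.
For the bound from above, cut the space into countably many cells of radius e, keep finitely many,
and solve the resulting finite partial transport problem: its duality is Farkas' lemma, a dual
solution extends to a test function by the c-transform, and an optimal plan lifts to the coupling
that is a product measure on each pair of cells. The errors vanish with e.
The dual formula for signed measures involves mu and nu only through int phi dmu - int phi dnu, so it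
is independent of the decompositions and satisfies the triangle inequality; it separates signed
measures because bounded Lipschitz functions approximate indicators of open sets from below.
*)
theory Submission
  imports Defs "HOL-Analysis.Finite_Function_Topology"
begin

section \<open>Finite partial transport\<close>

text \<open>Neither the independence of the decompositions nor the triangle inequality can be read
  off the infimum. Adding a common measure to both arguments of \<open>gen_W1\<close> clearly does
  not increase it, but that it does not decrease it is hidden, and chaining two competitors calls
  for a gluing of couplings. In the dual formula both are immediate, so the work lies in closing the
  duality gap. This is done up to an arbitrarily small error, so no optimal coupling of the measures
  themselves has to exist, and \<open>W1\<close> may be infinite. The constants of the dual problem
  are prices: mass may be deleted at price \<open>a\<close> at either end, which bounds a test
  function from both sides, and transport costs \<open>b\<close> per unit length, which is the
  Lipschitz constant. Competitors in the infimum may exceed \<open>\<mu>\<close> and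
  \<open>\<nu>\<close>, but those built for the upper bound are submeasures, for which total
  variation is a difference of masses.\<close>

text \<open>
  Bartl's induction on the number of constraints: if the first constraints alone do not force the
  conclusion, a violating \<open>x0\<close> is normalised on the new constraint, and everything is projected along it.
\<close>

lemma farkas:
  fixes A :: "'k \<Rightarrow> 'w::real_vector \<Rightarrow> real" and c :: "'w \<Rightarrow> real"
  assumes "finite K" and "\<And>k. k \<in> K \<Longrightarrow> linear (A k)" and "linear c"
    and "\<And>x. (\<forall>k\<in>K. A k x \<le> 0) \<Longrightarrow> c x \<le> 0"
  shows "\<exists>y. (\<forall>k\<in>K. 0 \<le> y k) \<and> (\<forall>x. c x = (\<Sum>k\<in>K. y k * A k x))"
  using assms
proof (induction K arbitrary: A c rule: finite_induct)
  case empty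
  have "c x \<le> 0" "c (- x) \<le> 0" for x
    using empty by auto
  then have "c x = 0" for x
    using linear_neg[OF empty(2)] by (metis antisym neg_le_0_iff_le)
  then show ?case by simp
next
  case (insert k0 K)
  have lin: "linear (A k)" if "k \<in> insert k0 K" for k
    using insert.prems(1) that by blast
  show ?case
  proof (cases "\<forall>x. (\<forall>k\<in>K. A k x \<le> 0) \<longrightarrow> c x \<le> 0")
    case True
    then obtain y where "\<forall>k\<in>K. 0 \<le> y k" "\<forall>x. c x = (\<Sum>k\<in>K. y k * A k x)"
      using insert.IH[of A c] lin insert.prems(2) by blast
    then show ?thesis
      using insert.hyps by (intro exI[of _ "y(k0 := 0)"]) (auto intro!: sum.cong)
  next
    case False
    then obtain x1 where x1: "\<forall>k\<in>K. A k x1 \<le> 0" "c x1 > 0" by force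
    \<comment> \<open>Otherwise \<open>x1\<close> would satisfy all constraints although
      \<open>c x1 > 0\<close>.\<close>
    then have pos: "A k0 x1 > 0"
      using insert.prems(3)[of x1] by force
    define x0 where "x0 = (1 / A k0 x1) *\<^sub>R x1"
    have x0: "A k x0 = A k x1 / A k0 x1" if "k \<in> insert k0 K" for k
      unfolding x0_def using linear_scale[OF lin[OF that]] by simp
    have cx0: "c x0 > 0"
      unfolding x0_def using linear_scale[OF insert.prems(2)] pos x1 by simp
    have Ak0: "A k0 x0 = 1" using x0[of k0] pos by simp
    define P where "P x = x - A k0 x *\<^sub>R x0" for x
    have linP: "linear P"
      unfolding P_def using lin[of k0]
      by (intro linearI) (auto simp: linear_add linear_scale algebra_simps)
    have P0: "A k0 (P x) = 0" for x
      unfolding P_def using linear_diff[OF lin] linear_scale[OF lin] Ak0 by simp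
    \<comment> \<open>The constraint \<open>k0\<close> holds with equality on the range of
      \<open>P\<close>, so after composition with \<open>P\<close> the constraints in
      \<open>K\<close> alone imply the conclusion.\<close>
    have "\<exists>y. (\<forall>k\<in>K. 0 \<le> y k) \<and> (\<forall>x. (c \<circ> P) x = (\<Sum>k\<in>K. y k * (A k \<circ> P) x))"
    proof (rule insert.IH)
      show "linear (A k \<circ> P)" if "k \<in> K" for k
        using linear_compose[OF linP lin] that by simp
      show "linear (c \<circ> P)"
        using linear_compose[OF linP insert.prems(2)] .
      show "(c \<circ> P) x \<le> 0" if "\<forall>k\<in>K. (A k \<circ> P) x \<le> 0" for x
        using insert.prems(3)[of "P x"] that P0[of x] by simp
    qed
    then obtain y where y: "\<forall>k\<in>K. 0 \<le> y k"
      and cy: "\<And>x. c (P x) = (\<Sum>k\<in>K. y k * A k (P x))" by auto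
    \<comment> \<open>As \<open>x\<close> is \<open>P x\<close> plus \<open>A k0 x\<close> times
      \<open>x0\<close>, the multiplier of \<open>k0\<close> is what \<open>c\<close> has left over
      at \<open>x0\<close>.\<close>
    define z where "z = c x0 - (\<Sum>k\<in>K. y k * A k x0)"
    have "A k x0 \<le> 0" if "k \<in> K" for k
      using x0[of k] that x1 pos by (simp add: divide_le_0_iff)
    then have "(\<Sum>k\<in>K. y k * A k x0) \<le> 0"
      using y by (intro sum_nonpos) (simp add: mult_nonneg_nonpos)
    then have z: "z \<ge> 0" using cx0 by (simp add: z_def)
    have "c x = z * A k0 x + (\<Sum>k\<in>K. y k * A k x)" for x
    proof -
      have "c x - A k0 x * c x0 = c (P x)"
        unfolding P_def using linear_diff[OF insert.prems(2)] linear_scale[OF insert.prems(2)] by simp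
      also have "\<dots> = (\<Sum>k\<in>K. y k * A k x - A k0 x * (y k * A k x0))"
        unfolding cy unfolding P_def using lin
        by (intro sum.cong) (auto simp: linear_diff linear_scale algebra_simps)
      finally show ?thesis
        by (simp add: z_def sum_subtractf sum_distrib_left algebra_simps)
    qed
    then show ?thesis
      using insert.hyps y z by (intro exI[of _ "y(k0 := z)"]) (auto intro!: sum.cong)
  qed
qed

lemma lookup_scaleR [simp]:
  "Poly_Mapping.lookup (r *\<^sub>R x) i = r *\<^sub>R Poly_Mapping.lookup x i"
proof -
  have "finite {i. r *\<^sub>R Poly_Mapping.lookup x i \<noteq> 0}"
    by (rule finite_subset[OF _ finite_lookup[of x]]) auto
  then show ?thesis by (simp add: scaleR_poly_mapping_def Abs_poly_mapping_inverse)
qed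

text \<open>Linear programming duality: any bound \<open>D\<close> on the dual value is matched by a
  plan of cost at most \<open>D\<close>. To apply Farkas' lemma, an extra variable
  \<open>h \<ge> 0\<close> multiplies the right-hand sides \<open>a\<close> and \<open>c i j\<close>
  as well as \<open>D\<close>, which makes all inequalities homogeneous.\<close>

lemma finite_partial_transport_duality:
  fixes p q :: "'i \<Rightarrow> real" and c :: "'i \<Rightarrow> 'i \<Rightarrow> real" and a D :: real
  assumes "finite I" and p: "\<And>i. i \<in> I \<Longrightarrow> 0 \<le> p i" and q: "\<And>i. i \<in> I \<Longrightarrow> 0 \<le> q i"
    and dual: "\<And>f g. \<lbrakk>\<forall>i\<in>I. f i \<le> a; \<forall>j\<in>I. g j \<le> a; \<forall>i\<in>I. \<forall>j\<in>I. f i + g j \<le> c i j\<rbrakk>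
      \<Longrightarrow> (\<Sum>i\<in>I. f i * p i) + (\<Sum>j\<in>I. g j * q j) \<le> D"
  obtains m where "\<And>i j. i \<in> I \<Longrightarrow> j \<in> I \<Longrightarrow> 0 \<le> m i j"
    "\<And>i. i \<in> I \<Longrightarrow> (\<Sum>j\<in>I. m i j) \<le> p i" "\<And>j. j \<in> I \<Longrightarrow> (\<Sum>i\<in>I. m i j) \<le> q j"
    "a * ((\<Sum>i\<in>I. p i - (\<Sum>j\<in>I. m i j)) + (\<Sum>j\<in>I. q j - (\<Sum>i\<in>I. m i j)))
      + (\<Sum>i\<in>I. \<Sum>j\<in>I. c i j * m i j) \<le> D"
proof -
  let ?l = Poly_Mapping.lookup
  \<comment> \<open>Finitely supported functions form a real vector space over any index type; only
    their values on \<open>I\<close> enter. The four summands of the key type index the constraints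
    on pairs, on \<open>f\<close>, on \<open>g\<close> and on \<open>h\<close>.\<close>
  define A :: "('i \<times> 'i) + 'i + 'i + unit \<Rightarrow> ('i \<Rightarrow>\<^sub>0 real) \<times> ('i \<Rightarrow>\<^sub>0 real) \<times> real \<Rightarrow> real" where
    "A k = (case k of Inl (i, j) \<Rightarrow> (\<lambda>(f, g, h). ?l f i + ?l g j - c i j * h)
      | Inr (Inl i) \<Rightarrow> (\<lambda>(f, g, h). ?l f i - a * h)
      | Inr (Inr (Inl j)) \<Rightarrow> (\<lambda>(f, g, h). ?l g j - a * h)
      | Inr (Inr (Inr _)) \<Rightarrow> (\<lambda>(f, g, h). - h))" for k
  define C :: "('i \<Rightarrow>\<^sub>0 real) \<times> ('i \<Rightarrow>\<^sub>0 real) \<times> real \<Rightarrow> real" where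
    "C = (\<lambda>(f, g, h). (\<Sum>i\<in>I. ?l f i * p i) + (\<Sum>j\<in>I. ?l g j * q j) - D * h)"
  let ?K = "(I \<times> I) <+> I <+> I <+> {()}"
  have "\<exists>y. (\<forall>k\<in>?K. 0 \<le> y k) \<and> (\<forall>x. C x = (\<Sum>k\<in>?K. y k * A k x))"
  proof (rule farkas)
    show "finite ?K" using \<open>finite I\<close> by simp
    show "linear (A k)" for k
      by (cases k rule: sum.exhaust)
        (auto simp: A_def lookup_add algebra_simps
          intro!: linearI split: sum.splits)
    show "linear C"
      by (auto simp: C_def lookup_add algebra_simps sum.distrib
          sum_distrib_left intro!: linearI)
    fix x assume K: "\<forall>k\<in>?K. A k x \<le> 0"
    obtain f g h where x: "x = (f, g, h)" by (cases x)
    have h: "h \<ge> 0"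
      and fa: "\<And>i. i \<in> I \<Longrightarrow> ?l f i \<le> a * h"
      and ga: "\<And>i. i \<in> I \<Longrightarrow> ?l g i \<le> a * h"
      and fg: "\<And>i j. \<lbrakk>i \<in> I; j \<in> I\<rbrakk> \<Longrightarrow> ?l f i + ?l g j \<le> c i j * h"
      using K by (auto simp: Plus_def ball_Un A_def x)
    show "C x \<le> 0"
    proof (cases "h = 0")
      \<comment> \<open>A direction at infinity: \<open>f\<close> and \<open>g\<close> are
        nonpositive on \<open>I\<close>, and the weights \<open>p\<close> and \<open>q\<close> are
        nonnegative.\<close>
      case True
      then have "(\<Sum>i\<in>I. ?l f i * p i) \<le> 0" "(\<Sum>i\<in>I. ?l g i * q i) \<le> 0"
        using fa ga p q by (auto intro!: sum_nonpos mult_nonpos_nonneg)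
      then show ?thesis by (simp add: C_def x True)
    next
      case False
      with h have "h > 0" by simp
      have "(\<Sum>i\<in>I. ?l f i / h * p i) + (\<Sum>j\<in>I. ?l g j / h * q j) \<le> D"
        using \<open>h > 0\<close> fa ga fg
        by (intro dual) (auto simp: pos_divide_le_eq add_divide_distrib[symmetric])
      moreover have "(\<Sum>i\<in>I. ?l f i / h * p i) = (\<Sum>i\<in>I. ?l f i * p i) / h"
        "(\<Sum>i\<in>I. ?l g i / h * q i) = (\<Sum>i\<in>I. ?l g i * q i) / h"
        by (simp_all add: sum_divide_distrib)
      ultimately show ?thesis
        using \<open>h > 0\<close> by (simp add: C_def x add_divide_distrib[symmetric] pos_divide_le_eq)
    qed
  qed
  then obtain y where y: "\<forall>k\<in>?K. 0 \<le> y k"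
    and Cy: "\<forall>x. C x = (\<Sum>k\<in>?K. y k * A k x)" by (elim exE conjE)
  \<comment> \<open>The multipliers are the primal variables: \<open>m\<close> is the plan,
    \<open>s\<close> and \<open>r\<close> are the untransported masses, \<open>t\<close> is the
    slack in the cost.\<close>
  define m where "m i j = y (Inl (i, j))" for i j
  define s where "s i = y (Inr (Inl i))" for i
  define r where "r j = y (Inr (Inr (Inl j)))" for j
  define t where "t = y (Inr (Inr (Inr ())))"
  have eq: "C x = (\<Sum>i\<in>I. \<Sum>j\<in>I. m i j * A (Inl (i, j)) x) + ((\<Sum>i\<in>I. s i * A (Inr (Inl i)) x)
      + ((\<Sum>j\<in>I. r j * A (Inr (Inr (Inl j))) x) + t * A (Inr (Inr (Inr ()))) x))" for x
    unfolding Cy[rule_format] using \<open>finite I\<close>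
    by (simp add: sum.Plus m_def s_def r_def t_def sum.cartesian_product case_prod_unfold)
  have m0: "0 \<le> m i j" and s0: "0 \<le> s i" and r0: "0 \<le> r j"
    if "i \<in> I" "j \<in> I" for i j
    using that by (auto simp: m_def s_def r_def intro!: y[rule_format] InlI InrI)
  have t0: "0 \<le> t" by (auto simp: t_def intro!: y[rule_format] InrI)
  have delta: "(\<Sum>k\<in>I. u k * ?l (Poly_Mapping.single i 1) k) = u i"
    "(\<Sum>k\<in>I. ?l (Poly_Mapping.single i 1) k * u k) = u i" if "i \<in> I" for i and u :: "'i \<Rightarrow> real"
    using that \<open>finite I\<close> by (simp_all add: lookup_single when_def if_distrib if_distribR sum.delta cong: if_cong)
  \<comment> \<open>Unit vectors in the three components of the variable read off the row sums, the
    column sums and the cost.\<close>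
  have pm: "p i = (\<Sum>j\<in>I. m i j) + s i" if "i \<in> I" for i
    using eq[of "(Poly_Mapping.single i 1, 0, 0)"]
    by (simp add: A_def C_def delta[OF that] sum_distrib_right[symmetric])
  have qm: "q j = (\<Sum>i\<in>I. m i j) + r j" if "j \<in> I" for j
    using eq[of "(0, Poly_Mapping.single j 1, 0)"]
    by (simp add: A_def C_def delta[OF that])
  have D: "D = (\<Sum>i\<in>I. \<Sum>j\<in>I. c i j * m i j) + a * (\<Sum>i\<in>I. s i) + a * (\<Sum>i\<in>I. r i) + t"
    using eq[of "(0, 0, 1)"]
    by (simp add: A_def C_def sum_negf sum_distrib_left mult.commute)
  show ?thesis
  proof
    show "a * ((\<Sum>i\<in>I. p i - (\<Sum>j\<in>I. m i j)) + (\<Sum>j\<in>I. q j - (\<Sum>i\<in>I. m i j)))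
      + (\<Sum>i\<in>I. \<Sum>j\<in>I. c i j * m i j) \<le> D"
      using t0 by (simp add: pm qm D distrib_left cong: sum.cong)
  qed (use m0 s0 r0 pm qm in auto)
qed

section \<open>Weak duality\<close>

text \<open>For \<open>a = b = 1\<close> this is the unit ball that defines the flat
  (Fortet-Mourier) metric.\<close>

definition test_functions :: "real \<Rightarrow> real \<Rightarrow> ('a::euclidean_space \<Rightarrow> real) set" where
  "test_functions a b = {\<phi>. (\<forall>x. \<bar>\<phi> x\<bar> \<le> a) \<and> b-lipschitz_on UNIV \<phi>}"

lemma test_functionsD:
  assumes "\<phi> \<in> test_functions a b"
  shows "\<bar>\<phi> x\<bar> \<le> a" "\<bar>\<phi> x - \<phi> y\<bar> \<le> b * norm (x - y)" "b-lipschitz_on UNIV \<phi>"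
    "\<phi> \<in> borel_measurable borel"
  using assms
  by (auto simp: test_functions_def lipschitz_on_def dist_norm
      intro!: borel_measurable_continuous_onI lipschitz_on_continuous_on[of b])

lemma uminus_test_functions:
  assumes "\<phi> \<in> test_functions a b"
  shows "(\<lambda>x. - \<phi> x) \<in> test_functions a b"
  using assms by (auto simp: test_functions_def)

lemma measurable_finite_borel_measures:
  assumes "\<mu> \<in> finite_borel_measures"
  shows "borel_measurable \<mu> = borel_measurable borel"
  using assms by (auto simp: finite_borel_measures_def intro: measurable_cong_sets)

lemma space_finite_borel_measures:
  "\<mu> \<in> finite_borel_measures \<Longrightarrow> space \<mu> = UNIV"
  using sets_eq_imp_space_eq[of \<mu> borel] by (auto simp: finite_borel_measures_def)

lemma integrable_bounded_borel:
  fixes \<phi> :: "'a::euclidean_space \<Rightarrow> real"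
  assumes "\<mu> \<in> finite_borel_measures" "\<phi> \<in> borel_measurable borel" "\<And>x. \<bar>\<phi> x\<bar> \<le> a"
  shows "integrable \<mu> \<phi>"
proof -
  interpret finite_measure \<mu> using assms by (simp add: finite_borel_measures_def)
  show ?thesis
    using assms measurable_finite_borel_measures[OF assms(1)]
    by (intro integrable_const_bound[where B=a]) auto
qed

text \<open>\<open>a - \<phi>\<close> is nonnegative and \<open>P\<close> dominates \<open>N\<close>
  inside \<open>Y\<close>, so its integral over \<open>Y\<close> is at least as large under
  \<open>P\<close>.\<close>

lemma integral_indicator_diff_le:
  fixes \<phi> :: "'a::euclidean_space \<Rightarrow> real"
  assumes P: "P \<in> finite_borel_measures" and N: "N \<in> finite_borel_measures"
    and Y: "Y \<in> sets borel"
    and le: "\<And>X. X \<in> sets borel \<Longrightarrow> X \<subseteq> Y \<Longrightarrow> emeasure N X \<le> emeasure P X"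
    and \<phi>: "\<phi> \<in> borel_measurable borel" "\<And>x. \<bar>\<phi> x\<bar> \<le> a"
  shows "(\<integral>x. indicator Y x * \<phi> x \<partial>P) - (\<integral>x. indicator Y x * \<phi> x \<partial>N)
    \<le> a * (measure P Y - measure N Y)"
proof -
  have s[simp, measurable_cong]: "sets P = sets borel" "sets N = sets borel"
    using P N by (auto simp: finite_borel_measures_def)
  note [measurable] = \<phi>(1) Y
  define f where "f x = indicator Y x * (a - \<phi> x)" for x
  have f0: "0 \<le> f x" for x using \<phi>(2)[of x] by (simp add: f_def indicator_def abs_le_iff)
  have [measurable]: "f \<in> borel_measurable borel" unfolding f_def by measurable
  have int: "integrable M (\<lambda>x. indicator Y x * \<phi> x)" "integrable M (indicator Y :: 'a \<Rightarrow> real)"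
    if "M \<in> finite_borel_measures" for M
  proof -
    have "0 \<le> a" using \<phi>(2)[of undefined] by simp
    then show "integrable M (\<lambda>x. indicator Y x * \<phi> x)"
      using that \<phi>(2) by (intro integrable_bounded_borel[where a=a]) (auto simp: indicator_def)
    show "integrable M (indicator Y :: 'a \<Rightarrow> real)"
      using that by (intro integrable_bounded_borel[where a=1]) (auto simp: indicator_def)
  qed
  have feq: "f = (\<lambda>x. a * indicator Y x - indicator Y x * \<phi> x)"
    by (auto simp: f_def algebra_simps)
  have fi: "integral\<^sup>L M f = a * measure M Y - (\<integral>x. indicator Y x * \<phi> x \<partial>M)"
    and fint: "integrable M f"
    if "M \<in> finite_borel_measures" for M
    unfolding feq using int[OF that] space_finite_borel_measures[OF that] by auto
  \<comment> \<open>Restriction to \<open>Y\<close> turns the domination on subsets of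
    \<open>Y\<close> into an inequality between measures.\<close>
  have "density N (indicator Y) \<le> density P (indicator Y)"
    by (subst le_measure) (simp_all add: emeasure_restricted Y le)
  then have "(\<integral>\<^sup>+x. f x \<partial>density N (indicator Y)) \<le> (\<integral>\<^sup>+x. f x \<partial>density P (indicator Y))"
    by (intro nn_integral_mono_measure) auto
  then have "(\<integral>\<^sup>+x. indicator Y x * ennreal (f x) \<partial>N) \<le> (\<integral>\<^sup>+x. indicator Y x * ennreal (f x) \<partial>P)"
    by (simp add: nn_integral_density)
  moreover have "indicator Y x * ennreal (f x) = ennreal (f x)" for x
    by (simp add: f_def indicator_def)
  ultimately have "(\<integral>\<^sup>+x. f x \<partial>N) \<le> (\<integral>\<^sup>+x. f x \<partial>P)"
    by simp
  then have "integral\<^sup>L N f \<le> integral\<^sup>L P f"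
    using fint[OF P] fint[OF N] f0 by (simp add: nn_integral_eq_integral integral_nonneg)
  then show ?thesis
    unfolding fi[OF P] fi[OF N] by (simp add: algebra_simps)
qed

text \<open>On a positive Hahn set the previous bound applies to \<open>\<phi>\<close>, on its
  complement to \<open>- \<phi>\<close> with the measures exchanged. These two sets form one of the
  partitions in the supremum.\<close>

lemma integral_diff_le_total_variation:
  fixes \<phi> :: "'a::euclidean_space \<Rightarrow> real"
  assumes P: "P \<in> finite_borel_measures" and N: "N \<in> finite_borel_measures"
    and \<phi>: "\<phi> \<in> borel_measurable borel" "\<And>x. \<bar>\<phi> x\<bar> \<le> a"
  shows "ennreal (integral\<^sup>L P \<phi> - integral\<^sup>L N \<phi>) \<le> ennreal a * total_variation (diff_measure P N)"
proof -
  have s: "sets P = sets borel" "sets N = sets borel"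
    and fin: "finite_measure P" "finite_measure N"
    using P N by (auto simp: finite_borel_measures_def)
  have a: "0 \<le> a" using \<phi>(2)[of undefined] by simp
  obtain Y where Y: "Y \<in> sets borel"
    and 1: "\<And>X. X \<in> sets borel \<Longrightarrow> X \<subseteq> Y \<Longrightarrow> emeasure N X \<le> emeasure P X"
    and 2: "\<And>X. X \<in> sets borel \<Longrightarrow> X \<inter> Y = {} \<Longrightarrow> emeasure P X \<le> emeasure N X"
    using finite_unsigned_Hahn_decomposition[OF fin] s by auto
  have Y': "- Y \<in> sets borel" using Y by auto
  let ?d = "diff_measure P N"
  have split: "integral\<^sup>L M \<phi> = (\<integral>x. indicator Y x * \<phi> x \<partial>M) + (\<integral>x. indicator (- Y) x * \<phi> x \<partial>M)"
    if "M \<in> finite_borel_measures" for M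
  proof -
    have "integrable M (\<lambda>x. indicator A x * \<phi> x)" if "A \<in> sets borel" for A
      using that \<phi> a \<open>M \<in> _\<close>
      by (intro integrable_bounded_borel[where a=a]) (auto simp: indicator_def)
    then have "(\<integral>x. indicator Y x * \<phi> x \<partial>M) + (\<integral>x. indicator (- Y) x * \<phi> x \<partial>M)
      = (\<integral>x. indicator Y x * \<phi> x + indicator (- Y) x * \<phi> x \<partial>M)"
      using Y Y' by simp
    also have "(\<lambda>x. indicator Y x * \<phi> x + indicator (- Y) x * \<phi> x) = \<phi>"
      by (auto simp: indicator_def)
    finally show ?thesis by simp
  qed
  have "(\<integral>x. indicator Y x * \<phi> x \<partial>P) - (\<integral>x. indicator Y x * \<phi> x \<partial>N) \<le> a * ?d Y"
    unfolding diff_measure_def using \<phi> 1 by (intro integral_indicator_diff_le P N Y) auto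
  moreover have "(\<integral>x. indicator (- Y) x * - \<phi> x \<partial>N) - (\<integral>x. indicator (- Y) x * - \<phi> x \<partial>P)
      \<le> a * (measure N (- Y) - measure P (- Y))"
    using \<phi> 2 by (intro integral_indicator_diff_le P N Y') auto
  ultimately have "integral\<^sup>L P \<phi> - integral\<^sup>L N \<phi> \<le> a * ?d Y + a * - ?d (- Y)"
    unfolding split[OF P] split[OF N] by (simp add: diff_measure_def)
  also have "\<dots> \<le> a * (\<bar>?d Y\<bar> + \<bar>?d (- Y)\<bar>)"
    unfolding distrib_left[symmetric] using a by (intro mult_left_mono add_mono) auto
  finally have "ennreal (integral\<^sup>L P \<phi> - integral\<^sup>L N \<phi>) \<le> ennreal (a * (\<bar>?d Y\<bar> + \<bar>?d (- Y)\<bar>))"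
    by (rule ennreal_leI)
  also have "\<dots> = ennreal a * (\<Sum>A\<in>{Y, - Y}. ennreal \<bar>?d A\<bar>)"
    using a by (subst sum.insert) (auto simp: ennreal_mult)
  \<comment> \<open>\<open>partition_on\<close> forbids empty blocks; an empty \<open>Y\<close> or
    \<open>- Y\<close> contributes 0.\<close>
  also have "(\<Sum>A\<in>{Y, - Y}. ennreal \<bar>?d A\<bar>) = (\<Sum>A\<in>{Y, - Y} - {{}}. ennreal \<bar>?d A\<bar>)"
    by (rule sum.mono_neutral_right) (auto simp: diff_measure_def)
  also have "\<dots> \<le> total_variation ?d"
    unfolding total_variation_def
    using Y Y' by (intro SUP_upper) (auto simp: partition_on_def disjoint_def)
  finally show ?thesis by (simp add: mult_left_mono)
qed

lemma integral_diff_le_W1: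
  assumes "0 < b" and P: "P \<in> finite_borel_measures" and \<phi>: "\<phi> \<in> test_functions a b"
  shows "ennreal ((integral\<^sup>L P \<phi> - integral\<^sup>L N \<phi>) / b) \<le> W1 P N"
  unfolding W1_def
proof (rule INF_greatest)
  fix \<pi> assume "\<pi> \<in> couplings P N"
  then have s[measurable_cong]: "sets \<pi> = sets (borel :: ('a \<times> 'a) measure)"
    and PN: "P = distr \<pi> borel fst" "N = distr \<pi> borel snd"
    by (auto simp: couplings_def)
  have [measurable]: "(fst :: 'a \<times> 'a \<Rightarrow> 'a) \<in> borel \<rightarrow>\<^sub>M borel" "(snd :: 'a \<times> 'a \<Rightarrow> 'a) \<in> borel \<rightarrow>\<^sub>M borel"
    by (auto intro!: borel_measurable_continuous_onI continuous_intros)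
  have [measurable]: "\<phi> \<in> borel_measurable borel" using test_functionsD[OF \<phi>] by simp
  have sp: "space \<pi> = UNIV" using sets_eq_imp_space_eq[OF s] by simp
  \<comment> \<open>A coupling has the mass of its first marginal, so it is finite and bounded
    functions are integrable.\<close>
  have "emeasure P UNIV = emeasure \<pi> UNIV"
    unfolding PN by (subst emeasure_distr) (auto simp: sp)
  then interpret finite_measure \<pi>
    using P by (intro finite_measureI)
      (auto simp: sp finite_borel_measures_def dest: finite_measure.emeasure_finite[of _ UNIV])
  have int: "integrable \<pi> (\<lambda>z. \<phi> (fst z))" "integrable \<pi> (\<lambda>z. \<phi> (snd z))"
    using test_functionsD(1)[OF \<phi>] by (auto intro!: integrable_const_bound[where B=a])
  have "(integral\<^sup>L P \<phi> - integral\<^sup>L N \<phi>) / b = (\<integral>z. (\<phi> (fst z) - \<phi> (snd z)) / b \<partial>\<pi>)"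
    unfolding PN using int by (simp add: integral_distr)
  \<comment> \<open>\<open>ennreal\<close> sends negative values to 0, so the integrand on the right
    is the positive part.\<close>
  also have "ennreal \<dots> \<le> (\<integral>\<^sup>+z. ennreal ((\<phi> (fst z) - \<phi> (snd z)) / b) \<partial>\<pi>)"
  proof -
    let ?f = "\<lambda>z. (\<phi> (fst z) - \<phi> (snd z)) / b"
    have i: "integrable \<pi> ?f" using int by simp
    then have "integral\<^sup>L \<pi> ?f \<le> (\<integral>z. max 0 (?f z) \<partial>\<pi>)"
      by (intro integral_mono) auto
    then have "ennreal (integral\<^sup>L \<pi> ?f) \<le> ennreal (\<integral>z. max 0 (?f z) \<partial>\<pi>)"
      by (rule ennreal_leI)
    also have "\<dots> = (\<integral>\<^sup>+z. ennreal (max 0 (?f z)) \<partial>\<pi>)"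
      using i by (intro nn_integral_eq_integral[symmetric]) auto
    also have "\<dots> = (\<integral>\<^sup>+z. ennreal (?f z) \<partial>\<pi>)"
      by (intro nn_integral_cong) (auto simp: max_def ennreal_neg)
    finally show ?thesis .
  qed
  also have "\<dots> \<le> (\<integral>\<^sup>+(x, y). ennreal (norm (x - y)) \<partial>\<pi>)"
  proof (intro nn_integral_mono)
    fix z :: "'a \<times> 'a"
    have "(\<phi> (fst z) - \<phi> (snd z)) / b \<le> norm (fst z - snd z)"
      using test_functionsD(2)[OF \<phi>, of "fst z" "snd z"] \<open>0 < b\<close>
      by (simp add: pos_divide_le_eq mult.commute abs_le_iff)
    then show "ennreal ((\<phi> (fst z) - \<phi> (snd z)) / b) \<le> (case z of (x, y) \<Rightarrow> ennreal (norm (x - y)))"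
      by (simp add: case_prod_unfold ennreal_leI)
  qed
  finally show "ennreal ((integral\<^sup>L P \<phi> - integral\<^sup>L N \<phi>) / b) \<le> \<dots>" .
qed

text \<open>Truncation at 0 is subadditive; equality fails for nonzero arguments of opposite
  signs.\<close>

lemma ennreal_add_le: "ennreal (x + y) \<le> ennreal x + ennreal y"
proof -
  have "ennreal (x + y) \<le> ennreal (max 0 x + max 0 y)"
    by (rule ennreal_leI) auto
  also have "\<dots> = ennreal x + ennreal y"
    by (simp add: ennreal_plus max_def ennreal_neg)
  finally show ?thesis .
qed

text \<open>For any competitor the difference telescopes into \<open>\<mu> - P\<close>,
  \<open>N - \<nu>\<close> and \<open>P - N\<close>, one for each term of the cost.\<close>

lemma integral_diff_le_gen_W1:
  assumes "0 < a" "0 < b" and \<mu>: "\<mu> \<in> finite_borel_measures" and \<nu>: "\<nu> \<in> finite_borel_measures"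
    and \<phi>: "\<phi> \<in> test_functions a b"
  shows "ennreal (integral\<^sup>L \<mu> \<phi> - integral\<^sup>L \<nu> \<phi>) \<le> gen_W1 a b \<mu> \<nu>"
  unfolding gen_W1_def
proof (intro INF_greatest, clarify)
  fix P N :: "'a measure"
  assume PN: "P \<in> finite_borel_measures" "N \<in> finite_borel_measures"
  note m = test_functionsD(4)[OF \<phi>] and bd = test_functionsD(1)[OF \<phi>]
  have eqm: "integral\<^sup>L M (\<lambda>x. - \<phi> x) = - integral\<^sup>L M \<phi>" for M by simp
  have "ennreal (integral\<^sup>L \<mu> \<phi> - integral\<^sup>L \<nu> \<phi>)
    = ennreal (((integral\<^sup>L \<mu> \<phi> - integral\<^sup>L P \<phi>) + (integral\<^sup>L N \<phi> - integral\<^sup>L \<nu> \<phi>))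
      + (integral\<^sup>L P \<phi> - integral\<^sup>L N \<phi>))"
    by (simp add: algebra_simps)
  also have "\<dots> \<le> (ennreal (integral\<^sup>L \<mu> \<phi> - integral\<^sup>L P \<phi>) + ennreal (integral\<^sup>L N \<phi> - integral\<^sup>L \<nu> \<phi>))
      + ennreal (integral\<^sup>L P \<phi> - integral\<^sup>L N \<phi>)"
    by (rule order_trans[OF ennreal_add_le add_right_mono[OF ennreal_add_le]])
  also have "\<dots> \<le> (ennreal a * total_variation (diff_measure \<mu> P) + ennreal a * total_variation (diff_measure \<nu> N))
      + ennreal b * W1 P N"
  proof (intro add_mono)
    show "ennreal (integral\<^sup>L \<mu> \<phi> - integral\<^sup>L P \<phi>) \<le> ennreal a * total_variation (diff_measure \<mu> P)"
      by (rule integral_diff_le_total_variation[OF \<mu> PN(1) m bd])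
    \<comment> \<open>The total variation bound is one-sided, so \<open>N - \<nu>\<close> is handled
      as \<open>\<nu> - N\<close> tested with \<open>- \<phi>\<close>.\<close>
    show "ennreal (integral\<^sup>L N \<phi> - integral\<^sup>L \<nu> \<phi>) \<le> ennreal a * total_variation (diff_measure \<nu> N)"
      using integral_diff_le_total_variation[OF \<nu> PN(2), of "\<lambda>x. - \<phi> x" a] m bd by simp
    have "ennreal b * ennreal ((integral\<^sup>L P \<phi> - integral\<^sup>L N \<phi>) / b) \<le> ennreal b * W1 P N"
      by (intro mult_left_mono integral_diff_le_W1[OF \<open>0 < b\<close> PN(1) \<phi>]) auto
    then show "ennreal (integral\<^sup>L P \<phi> - integral\<^sup>L N \<phi>) \<le> ennreal b * W1 P N"
      using \<open>0 < b\<close> by (simp add: ennreal_mult'[symmetric])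
  qed
  finally show "ennreal (integral\<^sup>L \<mu> \<phi> - integral\<^sup>L \<nu> \<phi>)
    \<le> ennreal a * (total_variation (diff_measure \<mu> P) + total_variation (diff_measure \<nu> N))
      + ennreal b * W1 P N"
    by (simp add: distrib_left)
qed

section \<open>Strong duality\<close>

text \<open>Balls around a countable dense set are made disjoint, and continuity from above makes
  the remainder small. The centre \<open>z i\<close> need not lie in \<open>C i\<close>.\<close>

lemma countable_small_cells:
  fixes \<mu> \<nu> :: "'a::euclidean_space measure"
  assumes \<mu>: "\<mu> \<in> finite_borel_measures" and \<nu>: "\<nu> \<in> finite_borel_measures" and "0 < e"
  obtains n :: nat and C z where "disjoint_family C" "\<And>i. C i \<in> sets borel" "\<And>i. C i \<subseteq> ball (z i) e"
    "measure \<mu> (- (\<Union>i<n. C i)) \<le> e" "measure \<nu> (- (\<Union>i<n. C i)) \<le> e"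
proof -
  obtain D :: "'a set" where D: "countable D" "\<And>X. open X \<Longrightarrow> X \<noteq> {} \<Longrightarrow> \<exists>d\<in>D. d \<in> X"
    using countable_dense_exists by auto
  have "D \<noteq> {}" using D(2)[of UNIV] by auto
  define z where "z = from_nat_into D"
  define B where "B i = ball (z i) e" for i
  define C where "C = disjointed B"
  have cover: "(\<Union>i. B i) = UNIV"
  proof (intro set_eqI iffI)
    fix x :: 'a
    obtain d where "d \<in> D" "d \<in> ball x e"
      using D(2)[of "ball x e"] \<open>0 < e\<close> by auto
    moreover obtain i where "z i = d"
      using from_nat_into_surj[OF D(1) \<open>d \<in> D\<close>] by (auto simp: z_def)
    ultimately show "x \<in> (\<Union>i. B i)" by (auto simp: B_def dist_commute)
  qed simp
  have C: "disjoint_family C" "C i \<in> sets borel" "C i \<subseteq> ball (z i) e" for i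
    unfolding C_def using disjoint_family_disjointed[of B] disjointed_subset[of B i]
    by (auto simp: B_def disjointed_def)
  have UC: "(\<Union>i<n. C i) = (\<Union>i<n. B i)" for n
    unfolding C_def using finite_UN_disjointed_eq[of B n] by (simp add: atLeast0LessThan)
  have lim: "(\<lambda>n. measure M (- (\<Union>i<n. C i))) \<longlonglongrightarrow> 0" if "M \<in> finite_borel_measures" for M
  proof -
    interpret finite_measure M using that by (simp add: finite_borel_measures_def)
    have "(\<lambda>n. measure M (- (\<Union>i<n. B i))) \<longlonglongrightarrow> measure M (\<Inter>n. - (\<Union>i<n. B i))"
      using that by (intro finite_Lim_measure_decseq)
        (fastforce simp: finite_borel_measures_def decseq_def B_def)+
    also have "(\<Inter>n. - (\<Union>i<n. B i)) = {}" using cover by blast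
    finally show ?thesis by (simp add: UC)
  qed
  have "\<forall>\<^sub>F n in sequentially. measure \<mu> (- (\<Union>i<n. C i)) < e \<and> measure \<nu> (- (\<Union>i<n. C i)) < e"
    using order_tendstoD(2)[OF lim[OF \<mu>] \<open>0 < e\<close>] order_tendstoD(2)[OF lim[OF \<nu>] \<open>0 < e\<close>]
    by (rule eventually_conj)
  then obtain n where "measure \<mu> (- (\<Union>i<n. C i)) < e \<and> measure \<nu> (- (\<Union>i<n. C i)) < e"
    unfolding eventually_sequentially by blast
  then show ?thesis using C by (intro that[of C z n]) auto
qed

text \<open>For a submeasure the absolute values disappear, so every partition yields the same
  difference of masses.\<close>

lemma total_variation_diff_le:
  assumes P: "P \<in> finite_borel_measures" and N: "N \<in> finite_borel_measures"
    and le: "\<And>A. A \<in> sets borel \<Longrightarrow> measure N A \<le> measure P A"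
  shows "total_variation (diff_measure P N) \<le> ennreal (measure P UNIV - measure N UNIV)"
  unfolding total_variation_def
proof (rule SUP_least)
  fix \<P> :: "'a set set"
  assume \<P>: "\<P> \<in> {\<P>. finite \<P> \<and> partition_on UNIV \<P> \<and> \<P> \<subseteq> sets borel}"
  have sum: "(\<Sum>A\<in>\<P>. measure M A) = measure M UNIV" if "M \<in> finite_borel_measures" for M
  proof -
    interpret finite_measure M using that by (simp add: finite_borel_measures_def)
    have "measure M (\<Union>A\<in>\<P>. A) = (\<Sum>A\<in>\<P>. measure M A)"
      using \<P> that
      by (intro finite_measure_finite_Union)
        (auto simp: finite_borel_measures_def partition_on_def disjoint_def disjoint_family_on_def)
    then show ?thesis using \<P> by (simp add: partition_on_def)
  qed
  have "(\<Sum>A\<in>\<P>. ennreal \<bar>diff_measure P N A\<bar>) = (\<Sum>A\<in>\<P>. ennreal (measure P A - measure N A))"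
    using \<P> le by (intro sum.cong) (auto simp: diff_measure_def abs_of_nonneg)
  also have "\<dots> = ennreal (\<Sum>A\<in>\<P>. measure P A - measure N A)"
    using \<P> le by (intro sum_ennreal) (auto simp: subset_iff)
  also have "(\<Sum>A\<in>\<P>. measure P A - measure N A) = measure P UNIV - measure N UNIV"
    by (simp add: sum_subtractf sum P N)
  finally show "(\<Sum>A\<in>\<P>. ennreal \<bar>diff_measure P N A\<bar>) \<le> ennreal (measure P UNIV - measure N UNIV)"
    by simp
qed

section \<open>Lifting a finite plan to a coupling\<close>

text \<open>\<open>k i j\<close> is the density of the lifted plan on a pair of cells, and
  \<open>u i\<close> the mass of a set within cell \<open>i\<close>. If \<open>p i > 0\<close>, row
  \<open>i\<close> contributes the fraction \<open>u i / p i\<close> of the plan's row sum, which is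
  at most \<open>p i\<close>. This puts the marginals of the lift below \<open>\<mu>\<close> and
  \<open>\<nu>\<close>.\<close>

lemma sum_plan_weights_le:
  fixes k m :: "nat \<Rightarrow> nat \<Rightarrow> real"
  assumes k: "\<And>i j. i < n \<Longrightarrow> j < n \<Longrightarrow> k i j * (p i * q j) = m i j"
    and k0: "\<And>i j. i < n \<Longrightarrow> j < n \<Longrightarrow> p i = 0 \<Longrightarrow> k i j = 0"
    and p: "\<And>i. i < n \<Longrightarrow> 0 \<le> p i"
    and m: "\<And>i. i < n \<Longrightarrow> (\<Sum>j<n. m i j) \<le> p i"
    and u: "\<And>i. i < n \<Longrightarrow> 0 \<le> u i"
  shows "(\<Sum>i<n. \<Sum>j<n. k i j * (u i * q j)) \<le> (\<Sum>i<n. u i)"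
proof (rule sum_mono)
  fix i assume i: "i \<in> {..<n}"
  show "(\<Sum>j<n. k i j * (u i * q j)) \<le> u i"
  proof (cases "p i = 0")
    case True
    then show ?thesis using i k0 u by simp
  next
    case False
    then have pos: "0 < p i" using p[of i] i by simp
    have "(\<Sum>j<n. k i j * (u i * q j)) = (\<Sum>j<n. u i / p i * m i j)"
      using i pos by (intro sum.cong) (auto simp: k[symmetric])
    also have "\<dots> = u i / p i * (\<Sum>j<n. m i j)" by (simp add: sum_distrib_left)
    also have "\<dots> \<le> u i / p i * p i"
      using i pos m u by (intro mult_left_mono) auto
    finally show ?thesis using pos by simp
  qed
qed

lemma sum_sum_ennreal:
  assumes "\<And>i j. i \<in> I \<Longrightarrow> j \<in> J \<Longrightarrow> 0 \<le> F i j"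
  shows "(\<Sum>i\<in>I. \<Sum>j\<in>J. ennreal (F i j)) = ennreal (\<Sum>i\<in>I. \<Sum>j\<in>J. F i j)"
proof -
  have "(\<Sum>i\<in>I. \<Sum>j\<in>J. ennreal (F i j)) = (\<Sum>i\<in>I. ennreal (\<Sum>j\<in>J. F i j))"
    using assms by (intro sum.cong refl sum_ennreal) auto
  also have "\<dots> = ennreal (\<Sum>i\<in>I. \<Sum>j\<in>J. F i j)"
    using assms by (intro sum_ennreal sum_nonneg) auto
  finally show ?thesis .
qed

text \<open>The marginals of the lifted plan are submeasures of mass
  \<open>\<Sum>i<n. \<Sum>j<n. m i j\<close>, which accounts for the deletion cost. Both endpoints
  lie within \<open>e\<close> of their centres, hence the extra \<open>2 * e\<close> in the
  distance.\<close>

lemma gen_W1_le_plan: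
  fixes \<mu> \<nu> :: "'a::euclidean_space measure" and C :: "nat \<Rightarrow> 'a set"
  assumes "0 < a" "0 < b" "0 < e"
    and \<mu>: "\<mu> \<in> finite_borel_measures" and \<nu>: "\<nu> \<in> finite_borel_measures"
    and disj: "disjoint_family C" and Cb: "\<And>i. C i \<in> sets borel" and Cz: "\<And>i. C i \<subseteq> ball (z i) e"
    and m0: "\<And>i j. i < n \<Longrightarrow> j < n \<Longrightarrow> 0 \<le> m i j"
    and row: "\<And>i. i < n \<Longrightarrow> (\<Sum>j<n. m i j) \<le> measure \<mu> (C i)"
    and col: "\<And>j. j < n \<Longrightarrow> (\<Sum>i<n. m i j) \<le> measure \<nu> (C j)"
  shows "gen_W1 a b \<mu> \<nu> \<le> ennreal (
    a * ((measure \<mu> UNIV - (\<Sum>i<n. \<Sum>j<n. m i j)) + (measure \<nu> UNIV - (\<Sum>i<n. \<Sum>j<n. m i j)))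
    + b * (\<Sum>i<n. \<Sum>j<n. (norm (z i - z j) + 2 * e) * m i j))"
proof -
  have s[simp, measurable_cong]: "sets \<mu> = sets borel" "sets \<nu> = sets borel"
    and fin: "finite_measure \<mu>" "finite_measure \<nu>"
    using \<mu> \<nu> by (auto simp: finite_borel_measures_def)
  interpret \<mu>: finite_measure \<mu> by fact
  interpret \<nu>: finite_measure \<nu> by fact
  interpret pair_sigma_finite \<mu> \<nu> ..
  note [measurable] = Cb
  have sp: "space \<mu> = UNIV" "space \<nu> = UNIV" using \<mu> \<nu> by (simp_all add: space_finite_borel_measures)
  let ?p = "\<lambda>i. measure \<mu> (C i)" and ?q = "\<lambda>j. measure \<nu> (C j)"
  txt \<open>If \<open>?p i\<close> or \<open>?q j\<close> is 0, then so is \<open>m i j\<close>, and the division yields the right value 0.\<close>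
  define k where "k i j = m i j / (?p i * ?q j)" for i j
  have m_le: "m i j \<le> ?p i" "m i j \<le> ?q j" if "i < n" "j < n" for i j
  proof -
    have "m i j \<le> (\<Sum>j<n. m i j)" "m i j \<le> (\<Sum>i<n. m i j)"
      using m0 that member_le_sum[of j "{..<n}" "m i"]
        member_le_sum[of i "{..<n}" "\<lambda>i. m i j"] by auto
    then show "m i j \<le> ?p i" "m i j \<le> ?q j"
      using row[OF that(1)] col[OF that(2)] by simp_all
  qed
  have k0: "0 \<le> k i j" if "i < n" "j < n" for i j
    using m0[OF that] by (simp add: k_def)
  have km: "k i j * (?p i * ?q j) = m i j" if "i < n" "j < n" for i j
    using m_le[OF that] m0[OF that] by (auto simp: k_def)
  define R where "R = \<mu> \<Otimes>\<^sub>M \<nu>"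
  have sR[measurable_cong]: "sets R = sets borel"
    unfolding R_def borel_prod[symmetric] by (intro sets_pair_measure_cong) auto
  have spR: "space R = UNIV" using sets_eq_imp_space_eq[OF sR] by simp
  have ER: "emeasure R (A \<times> B) = ennreal (measure \<mu> A * measure \<nu> B)"
    if "A \<in> sets borel" "B \<in> sets borel" for A B
    using that unfolding R_def
    by (subst \<nu>.emeasure_pair_measure_Times)
      (auto simp: \<mu>.emeasure_eq_measure \<nu>.emeasure_eq_measure ennreal_mult)
  have Cij[measurable]: "C i \<times> C j \<in> sets borel" for i j
    by (simp add: borel_Times Cb)
  define w where "w = (\<lambda>x. \<Sum>i<n. \<Sum>j<n. ennreal (k i j) * indicator (C i \<times> C j) x)"
  have [measurable]: "w \<in> borel_measurable borel" unfolding w_def by measurable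
  define \<pi> where "\<pi> = density R w"
  have s\<pi>[measurable_cong]: "sets \<pi> = sets borel" by (simp add: \<pi>_def sR)
  have int: "(\<integral>\<^sup>+x. f x \<partial>\<pi>) = (\<Sum>i<n. \<Sum>j<n. ennreal (k i j) * (\<integral>\<^sup>+x. f x * indicator (C i \<times> C j) x \<partial>R))"
    if [measurable]: "f \<in> borel_measurable borel" for f
  proof -
    have "(\<integral>\<^sup>+x. f x \<partial>\<pi>) = (\<integral>\<^sup>+x. (\<Sum>i<n. \<Sum>j<n. ennreal (k i j) * (f x * indicator (C i \<times> C j) x)) \<partial>R)"
    proof -
      have "w x * f x = (\<Sum>i<n. \<Sum>j<n. ennreal (k i j) * (f x * indicator (C i \<times> C j) x))" for x
        unfolding w_def sum_distrib_right by (intro sum.cong refl) (simp only: ac_simps)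
      moreover have "w \<in> borel_measurable R" "f \<in> borel_measurable R" by measurable
      ultimately show ?thesis
        unfolding \<pi>_def by (simp add: nn_integral_density)
    qed
    also have "\<dots> = (\<Sum>i<n. \<Sum>j<n. ennreal (k i j) * (\<integral>\<^sup>+x. f x * indicator (C i \<times> C j) x \<partial>R))"
      by (simp add: nn_integral_sum nn_integral_cmult)
    finally show ?thesis .
  qed
  \<comment> \<open>Rectangles suffice, because only the two marginals have to be computed.\<close>
  have emeasure_\<pi>: "emeasure \<pi> (A \<times> B) = ennreal (\<Sum>i<n. \<Sum>j<n. k i j * (measure \<mu> (C i \<inter> A) * measure \<nu> (C j \<inter> B)))"
    if [measurable]: "A \<in> sets borel" "B \<in> sets borel" for A B
  proof -
    have [measurable]: "A \<times> B \<in> sets borel" by (simp add: borel_Times that)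
    have "emeasure \<pi> (A \<times> B) = (\<integral>\<^sup>+x. indicator (A \<times> B) x \<partial>\<pi>)"
      by (simp add: s\<pi>)
    also have "\<dots> = (\<Sum>i<n. \<Sum>j<n. ennreal (k i j) * (\<integral>\<^sup>+x. indicator ((C i \<inter> A) \<times> (C j \<inter> B)) x \<partial>R))"
      by (subst int) (auto simp: indicator_def intro!: sum.cong arg_cong[where f="(*) _"] nn_integral_cong)
    also have "\<dots> = (\<Sum>i<n. \<Sum>j<n. ennreal (k i j * (measure \<mu> (C i \<inter> A) * measure \<nu> (C j \<inter> B))))"
      using Cb that k0 by (intro sum.cong refl) (simp add: sR borel_Times ER ennreal_mult)
    also have "\<dots> = ennreal (\<Sum>i<n. \<Sum>j<n. k i j * (measure \<mu> (C i \<inter> A) * measure \<nu> (C j \<inter> B)))"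
      using k0 by (intro sum_sum_ennreal) auto
    finally show ?thesis .
  qed
  have fs[measurable]: "(fst :: 'a \<times> 'a \<Rightarrow> 'a) \<in> borel \<rightarrow>\<^sub>M borel" "(snd :: 'a \<times> 'a \<Rightarrow> 'a) \<in> borel \<rightarrow>\<^sub>M borel"
    by (auto intro!: borel_measurable_continuous_onI continuous_intros)
  have sp\<pi>: "space \<pi> = UNIV" using sets_eq_imp_space_eq[OF s\<pi>] by simp
  define P where "P = distr \<pi> borel fst"
  define N where "N = distr \<pi> borel snd"
  have eP: "emeasure P A = ennreal (\<Sum>i<n. \<Sum>j<n. k i j * (measure \<mu> (C i \<inter> A) * ?q j))"
    if "A \<in> sets borel" for A
    using that emeasure_\<pi>[of A UNIV] unfolding P_def
    by (subst emeasure_distr) (auto simp: sp\<pi> fst_vimage_eq_Times)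
  have eN: "emeasure N A = ennreal (\<Sum>i<n. \<Sum>j<n. k i j * (?p i * measure \<nu> (C j \<inter> A)))"
    if "A \<in> sets borel" for A
    using that emeasure_\<pi>[of UNIV A] unfolding N_def
    by (subst emeasure_distr) (auto simp: sp\<pi> snd_vimage_eq_Times)
  have k_nonneg: "0 \<le> (\<Sum>i<n. \<Sum>j<n. k i j * (u i * v j))" if "\<And>i. 0 \<le> u i" "\<And>j. 0 \<le> v j" for u v
    using k0 that by (intro sum_nonneg mult_nonneg_nonneg) auto
  have mP: "measure P A = (\<Sum>i<n. \<Sum>j<n. k i j * (measure \<mu> (C i \<inter> A) * ?q j))"
    and mN: "measure N A = (\<Sum>i<n. \<Sum>j<n. k i j * (?p i * measure \<nu> (C j \<inter> A)))"
    if "A \<in> sets borel" for A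
    using eP[OF that] eN[OF that] k_nonneg by (simp_all add: measure_def)
  have spPN: "space P = UNIV" "space N = UNIV" by (simp_all add: P_def N_def)
  have PN: "P \<in> finite_borel_measures" "N \<in> finite_borel_measures"
    by (auto simp: finite_borel_measures_def P_def N_def)
      (auto simp: P_def[symmetric] N_def[symmetric] spPN eP eN intro!: finite_measureI)
  let ?M = "\<Sum>i<n. \<Sum>j<n. m i j"
  have kM: "(\<Sum>i<n. \<Sum>j<n. k i j * (?p i * ?q j)) = ?M"
    by (intro sum.cong refl) (simp add: km)
  have UP: "measure P UNIV = ?M" "emeasure P UNIV = ennreal ?M"
    and UN: "measure N UNIV = ?M" "emeasure N UNIV = ennreal ?M"
    by (simp_all add: mP mN eP eN kM)
  \<comment> \<open>The part of \<open>A\<close> outside the first \<open>n\<close> cells is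
    dropped, hence only an inequality.\<close>
  have sub: "(\<Sum>i<n. measure M (C i \<inter> A)) \<le> measure M A"
    if "M \<in> finite_borel_measures" "A \<in> sets borel" for M A
  proof -
    interpret finite_measure M using that by (simp add: finite_borel_measures_def)
    have sM: "sets M = sets borel" using that by (simp add: finite_borel_measures_def)
    have "(\<Sum>i<n. measure M (C i \<inter> A)) = measure M (\<Union>i<n. C i \<inter> A)"
      using disj that Cb
      by (intro finite_measure_finite_Union[symmetric]) (auto simp: sM disjoint_family_on_def)
    also have "\<dots> \<le> measure M A"
      using that by (intro finite_measure_mono) (auto simp: sM)
    finally show ?thesis .
  qed
  have PA: "measure P A \<le> measure \<mu> A" if "A \<in> sets borel" for A
  proof -
    have "measure P A \<le> (\<Sum>i<n. measure \<mu> (C i \<inter> A))"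
      unfolding mP[OF that] by (rule sum_plan_weights_le[OF km _ _ row]) (auto simp: k_def)
    then show ?thesis using sub[OF \<mu> that] by simp
  qed
  have NA: "measure N A \<le> measure \<nu> A" if "A \<in> sets borel" for A
  proof -
    \<comment> \<open>Transposed, so that columns take the place of rows in
      \<open>sum_plan_weights_le\<close>.\<close>
    have "measure N A = (\<Sum>j<n. \<Sum>i<n. k i j * (measure \<nu> (C j \<inter> A) * ?p i))"
      unfolding mN[OF that] by (subst sum.swap) (simp add: mult.commute)
    also have "\<dots> \<le> (\<Sum>j<n. measure \<nu> (C j \<inter> A))"
      by (rule sum_plan_weights_le[of n "\<lambda>j i. k i j" ?q ?p "\<lambda>j i. m i j"])
        (use km col in \<open>auto simp: k_def mult.commute\<close>)
    finally show ?thesis using sub[OF \<nu> that] by simp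
  qed
  have "W1 P N \<le> (\<integral>\<^sup>+ (x, y). ennreal (norm (x - y)) \<partial>\<pi>)"
    unfolding W1_def by (rule INF_lower) (simp add: couplings_def s\<pi> P_def N_def)
  also have "\<dots> = (\<Sum>i<n. \<Sum>j<n. ennreal (k i j) *
      (\<integral>\<^sup>+ x. ennreal (norm (fst x - snd x)) * indicator (C i \<times> C j) x \<partial>R))"
    unfolding case_prod_unfold by (rule int) measurable
  also have "\<dots> \<le> (\<Sum>i<n. \<Sum>j<n. ennreal ((norm (z i - z j) + 2 * e) * m i j))"
  proof (intro sum_mono)
    fix i j assume ij: "i \<in> {..<n}" "j \<in> {..<n}"
    let ?d = "norm (z i - z j) + 2 * e"
    have le: "norm (fst x - snd x) \<le> ?d" if "x \<in> C i \<times> C j" for x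
    proof -
      have "dist (z i) (fst x) < e" "dist (z j) (snd x) < e"
        using that Cz[of i] Cz[of j] by (auto simp: subset_iff)
      moreover have "dist (fst x) (snd x) \<le> dist (z i) (fst x) + dist (z i) (z j) + dist (z j) (snd x)"
        by metric
      ultimately show ?thesis by (simp add: dist_norm)
    qed
    have "(\<integral>\<^sup>+ x. ennreal (norm (fst x - snd x)) * indicator (C i \<times> C j) x \<partial>R)
        \<le> (\<integral>\<^sup>+ x. ennreal ?d * indicator (C i \<times> C j) x \<partial>R)"
      using le by (intro nn_integral_mono) (auto simp: indicator_def ennreal_leI)
    also have "\<dots> = ennreal (?d * (?p i * ?q j))"
      using \<open>0 < e\<close> by (simp add: nn_integral_cmult sR ER Cb ennreal_mult)
    finally have "ennreal (k i j) * (\<integral>\<^sup>+ x. ennreal (norm (fst x - snd x)) * indicator (C i \<times> C j) x \<partial>R)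
        \<le> ennreal (k i j) * ennreal (?d * (?p i * ?q j))"
      by (rule mult_left_mono) simp
    also have "\<dots> = ennreal (?d * (k i j * (?p i * ?q j)))"
      using k0 ij \<open>0 < e\<close> by (simp add: ennreal_mult[symmetric] mult.left_commute)
    finally show "ennreal (k i j) * (\<integral>\<^sup>+ x. ennreal (norm (fst x - snd x)) * indicator (C i \<times> C j) x \<partial>R)
        \<le> ennreal (?d * m i j)"
      using km ij by simp
  qed
  also have "\<dots> = ennreal (\<Sum>i<n. \<Sum>j<n. (norm (z i - z j) + 2 * e) * m i j)"
    using m0 \<open>0 < e\<close> by (intro sum_sum_ennreal mult_nonneg_nonneg) auto
  finally have W: "W1 P N \<le> ennreal (\<Sum>i<n. \<Sum>j<n. (norm (z i - z j) + 2 * e) * m i j)" .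
  have "gen_W1 a b \<mu> \<nu> \<le> ennreal a * (total_variation (diff_measure \<mu> P) + total_variation (diff_measure \<nu> N))
      + ennreal b * W1 P N"
    unfolding gen_W1_def by (rule INF_lower2[of "(P, N)"]) (auto simp: PN UP UN)
  also have "\<dots> \<le> ennreal a * (ennreal (measure \<mu> UNIV - ?M) + ennreal (measure \<nu> UNIV - ?M))
      + ennreal b * ennreal (\<Sum>i<n. \<Sum>j<n. (norm (z i - z j) + 2 * e) * m i j)"
    using total_variation_diff_le[OF \<mu> PN(1) PA] total_variation_diff_le[OF \<nu> PN(2) NA] W
    by (intro add_mono mult_left_mono) (auto simp: UP UN)
  also have "\<dots> = ennreal (a * ((measure \<mu> UNIV - ?M) + (measure \<nu> UNIV - ?M))
    + b * (\<Sum>i<n. \<Sum>j<n. (norm (z i - z j) + 2 * e) * m i j))"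
  proof -
    have "?M \<le> measure \<mu> UNIV" "?M \<le> measure \<nu> UNIV"
      using PA[of UNIV] NA[of UNIV] by (simp_all add: UP UN)
    moreover have "0 \<le> (\<Sum>i<n. \<Sum>j<n. (norm (z i - z j) + 2 * e) * m i j)"
      using m0 \<open>0 < e\<close> by (intro sum_nonneg mult_nonneg_nonneg) auto
    moreover have "ennreal a * (ennreal x + ennreal y) + ennreal b * ennreal w = ennreal (a * (x + y) + b * w)"
      if "0 \<le> x" "0 \<le> y" "0 \<le> w" for x y w
      using that \<open>0 < a\<close> \<open>0 < b\<close> by (simp add: ennreal_mult ennreal_plus)
    ultimately show ?thesis by simp
  qed
  finally show ?thesis .
qed

section \<open>From discrete dual solutions to test functions\<close>

text \<open>A minimum of \<open>b\<close>-Lipschitz functions is \<open>b\<close>-Lipschitz. The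
  bound \<open>g j \<le> a\<close> keeps it above \<open>- a\<close>, the joint constraint keeps
  every entry at \<open>z i\<close> above \<open>f i\<close>, and the entry with index
  \<open>j\<close>, taken at \<open>z j\<close>, gives the bound on \<open>g j\<close>.\<close>

lemma c_transform:
  fixes z :: "nat \<Rightarrow> 'a::euclidean_space"
  assumes "0 \<le> a" "0 \<le> b"
    and f: "\<And>i. i < n \<Longrightarrow> f i \<le> a" and g: "\<And>j. j < n \<Longrightarrow> g j \<le> a"
    and fg: "\<And>i j. i < n \<Longrightarrow> j < n \<Longrightarrow> f i + g j \<le> b * norm (z i - z j)"
  obtains \<phi> where "\<phi> \<in> test_functions a b" "\<And>i. i < n \<Longrightarrow> f i \<le> \<phi> (z i)" "\<And>j. j < n \<Longrightarrow> g j \<le> - \<phi> (z j)"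
proof -
  \<comment> \<open>The constant \<open>a\<close> caps the minimum and keeps it defined for
    \<open>n = 0\<close>.\<close>
  define S where "S x = insert a ((\<lambda>j. b * norm (x - z j) - g j) ` {..<n})" for x
  define \<phi> where "\<phi> x = Min (S x)" for x
  have fin: "finite (S x)" "S x \<noteq> {}" for x by (simp_all add: S_def)
  have upper: "\<phi> x \<le> a" for x unfolding \<phi>_def by (rule Min_le) (auto simp: S_def)
  have upper': "\<phi> x \<le> b * norm (x - z j) - g j" if "j < n" for x j
    unfolding \<phi>_def using that by (intro Min_le) (auto simp: S_def)
  have cases: "\<phi> x = a \<or> (\<exists>j<n. \<phi> x = b * norm (x - z j) - g j)" for x
    using Min_in[OF fin, of x] unfolding \<phi>_def[symmetric] by (auto simp: S_def)
  have lower: "- a \<le> \<phi> x" for x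
    using cases[of x]
  proof (elim disjE exE conjE)
    fix j assume "j < n" "\<phi> x = b * norm (x - z j) - g j"
    moreover have "0 \<le> b * norm (x - z j)" using \<open>0 \<le> b\<close> by simp
    ultimately show ?thesis using g[of j] by linarith
  qed (use \<open>0 \<le> a\<close> in simp)
  have le: "\<phi> x \<le> \<phi> y + b * norm (x - y)" for x y
    using cases[of y]
  proof (elim disjE exE conjE)
    assume "\<phi> y = a"
    moreover have "0 \<le> b * norm (x - y)" using \<open>0 \<le> b\<close> by simp
    ultimately show ?thesis using upper[of x] by linarith
  next
    fix j assume j: "j < n" "\<phi> y = b * norm (y - z j) - g j"
    have "b * norm (x - z j) \<le> b * (norm (x - y) + norm (y - z j))"
      using \<open>0 \<le> b\<close> norm_triangle_ineq[of "x - y" "y - z j"] by (intro mult_left_mono) auto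
    then show ?thesis using upper'[OF j(1), of x] j(2) by (simp add: distrib_left)
  qed
  show thesis
  proof
    show "\<phi> \<in> test_functions a b"
      unfolding test_functions_def
    proof (intro CollectI conjI allI lipschitz_onI)
      show "\<bar>\<phi> x\<bar> \<le> a" for x using upper[of x] lower[of x] by simp
      show "dist (\<phi> x) (\<phi> y) \<le> b * dist x y" for x y
        using le[of x y] le[of y x] by (simp add: dist_norm norm_minus_commute abs_le_iff)
    qed fact
    show "f i \<le> \<phi> (z i)" if "i < n" for i
      using cases[of "z i"] f[OF that] fg[OF that] by force
    show "g j \<le> - \<phi> (z j)" if "j < n" for j
      using upper'[OF that, of "z j"] by simp
  qed
qed

text \<open>Two errors: within a cell \<open>\<phi> (z i)\<close> exceeds \<open>\<phi> x\<close> by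
  at most \<open>b * e\<close>, and outside the cells the step function is 0 while
  \<open>\<phi>\<close> may be as low as \<open>- a\<close>.\<close>

lemma step_sum_le_integral:
  fixes z :: "nat \<Rightarrow> 'a::euclidean_space"
  assumes \<mu>: "\<mu> \<in> finite_borel_measures" and \<phi>: "\<phi> \<in> test_functions a b" and "0 \<le> b" "0 \<le> e"
    and disj: "disjoint_family C" and Cb: "\<And>i. C i \<in> sets borel" and Cz: "\<And>i. C i \<subseteq> ball (z i) e"
  shows "(\<Sum>i<n. \<phi> (z i) * measure \<mu> (C i))
    \<le> integral\<^sup>L \<mu> \<phi> + b * e * measure \<mu> UNIV + a * measure \<mu> (- (\<Union>i<n. C i))"
proof -
  interpret finite_measure \<mu> using \<mu> by (simp add: finite_borel_measures_def)
  have s[simp, measurable_cong]: "sets \<mu> = sets borel" using \<mu> by (simp add: finite_borel_measures_def)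
  have sp[simp]: "space \<mu> = UNIV" using \<mu> by (rule space_finite_borel_measures)
  note [measurable] = Cb
  let ?R = "- (\<Union>i<n. C i)"
  have "(\<Union>i<n. C i) \<in> sets borel" using Cb by auto
  then have R[measurable]: "?R \<in> sets borel" by (rule borel_comp)
  have int\<phi>: "integrable \<mu> \<phi>"
    by (rule integrable_bounded_borel[OF \<mu> test_functionsD(4,1)[OF \<phi>]])
  have ind: "integrable \<mu> (indicator A :: 'a \<Rightarrow> real)" if "A \<in> sets borel" for A
    using that by (intro integrable_bounded_borel[OF \<mu>, where a=1]) (auto simp: indicator_def)
  have "(\<Sum>i<n. \<phi> (z i) * measure \<mu> (C i)) = (\<integral>x. (\<Sum>i<n. \<phi> (z i) * indicator (C i) x) \<partial>\<mu>)"
    using ind Cb by (subst Bochner_Integration.integral_sum) auto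
  also have "\<dots> \<le> (\<integral>x. \<phi> x + b * e + a * indicator ?R x \<partial>\<mu>)"
  proof (rule integral_mono)
    show "integrable \<mu> (\<lambda>x. \<Sum>i<n. \<phi> (z i) * indicator (C i) x)"
      by (intro Bochner_Integration.integrable_sum integrable_mult_right ind Cb)
    show "integrable \<mu> (\<lambda>x. \<phi> x + b * e + a * indicator ?R x)" using ind[OF R] int\<phi> by simp
    fix x
    have be: "0 \<le> b * e" using \<open>0 \<le> b\<close> \<open>0 \<le> e\<close> by simp
    show "(\<Sum>i<n. \<phi> (z i) * indicator (C i) x) \<le> \<phi> x + b * e + a * indicator ?R x"
    proof (cases "x \<in> ?R")
      case True
      then have "(\<Sum>i<n. \<phi> (z i) * indicator (C i) x) = 0" by (intro sum.neutral) auto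
      then show ?thesis using True test_functionsD(1)[OF \<phi>, of x] be by simp
    next
      case False
      then obtain k where k: "k < n" "x \<in> C k" by auto
      have "(\<Sum>i<n. \<phi> (z i) * indicator (C i) x) = (\<Sum>i\<in>{k}. \<phi> (z i) * indicator (C i) x)"
        using k disj by (intro sum.mono_neutral_right) (auto simp: disjoint_family_on_def indicator_def)
      also have "\<dots> = \<phi> (z k)" using k by simp
      also have "\<dots> \<le> \<phi> x + b * norm (z k - x)"
        using test_functionsD(2)[OF \<phi>, of "z k" x] by simp
      also have "\<dots> \<le> \<phi> x + b * e"
        using Cz[of k] k \<open>0 \<le> b\<close> by (intro add_left_mono mult_left_mono) (auto simp: dist_norm subset_iff less_imp_le)
      finally show ?thesis using False by simp
    qed
  qed
  also have "\<dots> = integral\<^sup>L \<mu> \<phi> + b * e * measure \<mu> UNIV + a * measure \<mu> ?R"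
    using ind[OF R] int\<phi> R by simp
  finally show ?thesis .
qed

text \<open>The error adds up as follows. Passing to step functions costs \<open>b * e\<close> times
  both masses plus \<open>2 * a * e\<close>; deleting the mass outside the cells costs another
  \<open>2 * a * e\<close>; the width of the cells costs \<open>2 * b * e\<close> times the
  transported mass.\<close>

lemma gen_W1_le_dual:
  fixes \<mu> \<nu> :: "'a::euclidean_space measure"
  assumes "0 < a" "0 < b" and \<mu>: "\<mu> \<in> finite_borel_measures" and \<nu>: "\<nu> \<in> finite_borel_measures"
    and dual: "\<And>\<phi>. \<phi> \<in> test_functions a b \<Longrightarrow> integral\<^sup>L \<mu> \<phi> - integral\<^sup>L \<nu> \<phi> \<le> d"
    and "0 < e"
  shows "gen_W1 a b \<mu> \<nu> \<le> ennreal (d + e * (3 * b * measure \<mu> UNIV + b * measure \<nu> UNIV + 4 * a))"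
proof -
  obtain n :: nat and C :: "nat \<Rightarrow> 'a set" and z :: "nat \<Rightarrow> 'a" where disj: "disjoint_family C"
    and Cb: "\<And>i. C i \<in> sets borel" and Cz: "\<And>i. C i \<subseteq> ball (z i) e"
    and rest: "measure \<mu> (- (\<Union>i<n. C i)) \<le> e" "measure \<nu> (- (\<Union>i<n. C i)) \<le> e"
    using countable_small_cells[OF \<mu> \<nu> \<open>0 < e\<close>] by metis
  define p where "p i = measure \<mu> (C i)" for i
  define q where "q i = measure \<nu> (C i)" for i
  define D where "D = d + b * e * (measure \<mu> UNIV + measure \<nu> UNIV) + 2 * a * e"
  have discrete: "(\<Sum>i<n. f i * p i) + (\<Sum>j<n. g j * q j) \<le> D"
    if f: "\<And>i. i < n \<Longrightarrow> f i \<le> a" and g: "\<And>j. j < n \<Longrightarrow> g j \<le> a"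
    and fg: "\<And>i j. i < n \<Longrightarrow> j < n \<Longrightarrow> f i + g j \<le> b * norm (z i - z j)" for f g
  proof -
    obtain \<phi> where \<phi>: "\<phi> \<in> test_functions a b" and f\<phi>: "\<And>i. i < n \<Longrightarrow> f i \<le> \<phi> (z i)"
      and g\<phi>: "\<And>j. j < n \<Longrightarrow> g j \<le> - \<phi> (z j)"
      using c_transform[of a b n f g z] f g fg \<open>0 < a\<close> \<open>0 < b\<close> by (metis less_imp_le)
    have "(\<Sum>i<n. f i * p i) \<le> (\<Sum>i<n. \<phi> (z i) * measure \<mu> (C i))"
      using f\<phi> by (intro sum_mono) (auto simp: p_def mult_right_mono)
    also have "\<dots> \<le> integral\<^sup>L \<mu> \<phi> + b * e * measure \<mu> UNIV + a * measure \<mu> (- (\<Union>i<n. C i))"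
      using \<open>0 < b\<close> \<open>0 < e\<close> by (intro step_sum_le_integral[OF \<mu> \<phi> _ _ disj Cb Cz]) auto
    finally have 1: "(\<Sum>i<n. f i * p i) \<le> \<dots>" .
    have "(\<Sum>j<n. g j * q j) \<le> (\<Sum>j<n. - \<phi> (z j) * measure \<nu> (C j))"
      unfolding q_def using g\<phi> by (intro sum_mono mult_right_mono) auto
    also have "\<dots> \<le> (\<integral>x. - \<phi> x \<partial>\<nu>) + b * e * measure \<nu> UNIV + a * measure \<nu> (- (\<Union>i<n. C i))"
      using \<open>0 < b\<close> \<open>0 < e\<close>
      by (intro step_sum_le_integral[OF \<nu> uminus_test_functions[OF \<phi>] _ _ disj Cb Cz]) auto
    finally have 2: "(\<Sum>j<n. g j * q j) \<le> - integral\<^sup>L \<nu> \<phi> + b * e * measure \<nu> UNIV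
        + a * measure \<nu> (- (\<Union>i<n. C i))" by simp
    have 3: "a * measure \<mu> (- (\<Union>i<n. C i)) \<le> a * e" "a * measure \<nu> (- (\<Union>i<n. C i)) \<le> a * e"
      using rest \<open>0 < a\<close> by (auto intro: mult_left_mono)
    show ?thesis
      using 1 2 3 dual[OF \<phi>] unfolding D_def by (simp add: algebra_simps)
  qed
  obtain m where m0: "\<And>i j. i < n \<Longrightarrow> j < n \<Longrightarrow> 0 \<le> m i j"
    and row: "\<And>i. i < n \<Longrightarrow> (\<Sum>j<n. m i j) \<le> p i" and col: "\<And>j. j < n \<Longrightarrow> (\<Sum>i<n. m i j) \<le> q j"
    and cost: "a * ((\<Sum>i<n. p i - (\<Sum>j<n. m i j)) + (\<Sum>j<n. q j - (\<Sum>i<n. m i j)))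
      + (\<Sum>i<n. \<Sum>j<n. b * norm (z i - z j) * m i j) \<le> D"
    by (rule finite_partial_transport_duality[of "{..<n}" p q a "\<lambda>i j. b * norm (z i - z j)" D])
      (use discrete in \<open>auto simp: p_def q_def\<close>)
  let ?M = "\<Sum>i<n. \<Sum>j<n. m i j"
  have mass: "measure N UNIV \<le> (\<Sum>i<n. measure N (C i)) + measure N (- (\<Union>i<n. C i))"
    "(\<Sum>i<n. measure N (C i)) \<le> measure N UNIV"
    if "N \<in> finite_borel_measures" for N
  proof -
    interpret finite_measure N using that by (simp add: finite_borel_measures_def)
    have s[simp]: "sets N = sets borel" using that by (simp add: finite_borel_measures_def)
    have sp: "space N = UNIV" using that by (rule space_finite_borel_measures)
    have U: "(\<Union>i<n. C i) \<in> sets N" using Cb by auto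
    have "(\<Sum>i<n. measure N (C i)) = measure N (\<Union>i<n. C i)"
      using disj Cb by (intro finite_measure_finite_Union[symmetric]) (auto simp: disjoint_family_on_def)
    then show "measure N UNIV \<le> (\<Sum>i<n. measure N (C i)) + measure N (- (\<Union>i<n. C i))"
      "(\<Sum>i<n. measure N (C i)) \<le> measure N UNIV"
      using finite_measure_compl[OF U] bounded_measure[of "\<Union>i<n. C i"]
      by (simp_all add: sp Compl_eq_Diff_UNIV)
  qed
  \<comment> \<open>Bounding the transported mass by that of \<open>\<mu>\<close> makes the
    coefficients 3 and 1 asymmetric.\<close>
  have "?M \<le> (\<Sum>i<n. p i)" using row by (intro sum_mono) auto
  then have M: "?M \<le> measure \<mu> UNIV" using mass(2)[OF \<mu>] by (simp add: p_def)
  have "gen_W1 a b \<mu> \<nu> \<le> ennreal (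
    a * ((measure \<mu> UNIV - ?M) + (measure \<nu> UNIV - ?M))
    + b * (\<Sum>i<n. \<Sum>j<n. (norm (z i - z j) + 2 * e) * m i j))"
    using row col m0 unfolding p_def q_def
    by (intro gen_W1_le_plan[OF assms(1,2) \<open>0 < e\<close> \<mu> \<nu> disj Cb Cz]) auto
  also have "\<dots> \<le> ennreal (d + e * (3 * b * measure \<mu> UNIV + b * measure \<nu> UNIV + 4 * a))"
  proof (rule ennreal_leI)
    have "a * ((measure \<mu> UNIV - ?M) + (measure \<nu> UNIV - ?M))
        \<le> a * (((\<Sum>i<n. p i) + e - ?M) + ((\<Sum>j<n. q j) + e - ?M))"
      using mass(1)[OF \<mu>] mass(1)[OF \<nu>] rest \<open>0 < a\<close>
      by (intro mult_left_mono) (auto simp: p_def q_def)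
    \<comment> \<open>Row sums and column sums both total \<open>?M\<close>.\<close>
    also have "\<dots> = a * ((\<Sum>i<n. p i - (\<Sum>j<n. m i j)) + (\<Sum>j<n. q j - (\<Sum>i<n. m i j))) + 2 * a * e"
      using sum.swap[of m "{..<n}" "{..<n}"] by (simp add: sum_subtractf algebra_simps)
    finally have 1: "a * ((measure \<mu> UNIV - ?M) + (measure \<nu> UNIV - ?M)) \<le> \<dots>" .
    have 2: "b * (\<Sum>i<n. \<Sum>j<n. (norm (z i - z j) + 2 * e) * m i j)
      = (\<Sum>i<n. \<Sum>j<n. b * norm (z i - z j) * m i j) + 2 * b * e * ?M"
      by (simp add: sum_distrib_left sum.distrib[symmetric] algebra_simps)
    have 3: "2 * b * e * ?M \<le> 2 * b * e * measure \<mu> UNIV"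
      using M \<open>0 < b\<close> \<open>0 < e\<close> by (intro mult_left_mono) auto
    show "a * ((measure \<mu> UNIV - ?M) + (measure \<nu> UNIV - ?M))
        + b * (\<Sum>i<n. \<Sum>j<n. (norm (z i - z j) + 2 * e) * m i j)
      \<le> d + e * (3 * b * measure \<mu> UNIV + b * measure \<nu> UNIV + 4 * a)"
      using 1 2 3 cost unfolding D_def by (simp add: algebra_simps)
  qed
  finally show ?thesis .
qed

lemma gen_W1_duality:
  fixes \<mu> \<nu> :: "'a::euclidean_space measure"
  assumes "0 < a" "0 < b" and \<mu>: "\<mu> \<in> finite_borel_measures" and \<nu>: "\<nu> \<in> finite_borel_measures"
  shows "gen_W1 a b \<mu> \<nu> = (SUP \<phi>\<in>test_functions a b. ennreal (integral\<^sup>L \<mu> \<phi> - integral\<^sup>L \<nu> \<phi>))"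
    (is "_ = ?S")
proof (rule antisym)
  show "?S \<le> gen_W1 a b \<mu> \<nu>"
    by (intro SUP_least integral_diff_le_gen_W1 assms)
  define d where "d = enn2real ?S"
  \<comment> \<open>Weak duality makes the supremum finite, so it can serve as the real bound
    \<open>d\<close>.\<close>
  have "?S < top"
    using \<open>?S \<le> gen_W1 a b \<mu> \<nu>\<close> gen_W1_finite[OF \<mu> \<nu>, of a b] by (simp add: less_top top.not_eq_extremum)
  then have d: "?S = ennreal d" "0 \<le> d" by (simp_all add: d_def)
  have dual: "integral\<^sup>L \<mu> \<phi> - integral\<^sup>L \<nu> \<phi> \<le> d" if "\<phi> \<in> test_functions a b" for \<phi>
  proof -
    have "ennreal (integral\<^sup>L \<mu> \<phi> - integral\<^sup>L \<nu> \<phi>) \<le> ennreal d"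
      using SUP_upper[OF that, of "\<lambda>\<phi>. ennreal (integral\<^sup>L \<mu> \<phi> - integral\<^sup>L \<nu> \<phi>)"] d by simp
    then show ?thesis using d(2) by (auto simp: ennreal_le_iff2)
  qed
  define K where "K = 3 * b * measure \<mu> UNIV + b * measure \<nu> UNIV + 4 * a"
  have K: "0 < K" unfolding K_def using assms(1,2) by (intro add_nonneg_pos) auto
  show "gen_W1 a b \<mu> \<nu> \<le> ?S"
  proof (rule ennreal_le_epsilon)
    fix e :: real assume "0 < e"
    \<comment> \<open>Cells of radius \<open>e / K\<close> make the total error exactly
      \<open>e\<close>.\<close>
    then have "gen_W1 a b \<mu> \<nu> \<le> ennreal (d + e / K * K)"
      unfolding K_def using K
      by (intro gen_W1_le_dual assms dual) (auto simp: K_def)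
    also have "\<dots> = ?S + ennreal e" using K d \<open>0 < e\<close> by simp
    finally show "gen_W1 a b \<mu> \<nu> \<le> ?S + ennreal e" .
  qed
qed

section \<open>Signed measures\<close>

lemma nn_integral_add_measure:
  assumes s: "sets \<mu> = sets borel" "sets \<nu> = sets borel" and f: "f \<in> borel_measurable borel"
  shows "(\<integral>\<^sup>+x. f x \<partial>add_measure \<mu> \<nu>) = (\<integral>\<^sup>+x. f x \<partial>\<mu>) + (\<integral>\<^sup>+x. f x \<partial>\<nu>)"
  using f
proof (induction rule: borel_measurable_induct)
  have [simp]: "space \<mu> = UNIV" "space \<nu> = UNIV" "space (add_measure \<mu> \<nu>) = UNIV"
    using s[THEN sets_eq_imp_space_eq] sets_eq_imp_space_eq[OF sets_add_measure] by simp_all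
  note [measurable_cong] = s sets_add_measure
  {
    case (cong f g)
    then show ?case by (simp cong: nn_integral_cong)
  next
    case (set A)
    then show ?case by (simp add: s emeasure_add_measure)
  next
    case (mult u c)
    note [measurable] = mult.hyps(2)
    show ?case using mult.IH by (simp add: nn_integral_cmult distrib_left)
  next
    case (add u v)
    note [measurable] = add.hyps(1,3)
    show ?case using add.IH by (simp add: nn_integral_add ac_simps)
  next
    case (seq U)
    note [measurable] = seq.hyps(1)
    \<comment> \<open>Monotonicity lets the supremum of the sums split into the sum of the
      suprema.\<close>
    have mono: "incseq (\<lambda>i. \<integral>\<^sup>+x. U i x \<partial>M)" for M
      using seq.hyps(3) by (auto simp: incseq_def le_fun_def intro!: nn_integral_mono)
    have "(\<integral>\<^sup>+x. Sup (range U) x \<partial>M) = (SUP i. \<integral>\<^sup>+x. U i x \<partial>M)"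
      if "sets M = sets borel" for M
      using nn_integral_monotone_convergence_SUP[OF seq.hyps(3), of M] seq.hyps(1) that
      by (simp add: SUP_apply image_comp measurable_cong_sets[OF that refl])
    then show ?case using s seq.IH mono by (simp add: ennreal_SUP_add)
  }
qed

lemma integral_add_measure:
  fixes \<phi> :: "'a::euclidean_space \<Rightarrow> real"
  assumes \<mu>: "\<mu> \<in> finite_borel_measures" and \<nu>: "\<nu> \<in> finite_borel_measures"
    and \<phi>: "\<phi> \<in> borel_measurable borel" "\<And>x. \<bar>\<phi> x\<bar> \<le> a"
  shows "integral\<^sup>L (add_measure \<mu> \<nu>) \<phi> = integral\<^sup>L \<mu> \<phi> + integral\<^sup>L \<nu> \<phi>"
proof -
  have s: "sets \<mu> = sets borel" "sets \<nu> = sets borel"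
    using \<mu> \<nu> by (auto simp: finite_borel_measures_def)
  have int: "integrable M f" "(\<integral>\<^sup>+x. ennreal (f x) \<partial>M) < top"
    if "M \<in> finite_borel_measures" "f = \<phi> \<or> f = (\<lambda>x. - \<phi> x)" for M f
  proof -
    show i: "integrable M f"
      using that \<phi> by (intro integrable_bounded_borel[where a=a]) auto
    have "(\<integral>\<^sup>+x. ennreal (f x) \<partial>M) \<le> (\<integral>\<^sup>+x. ennreal (norm (f x)) \<partial>M)"
      by (intro nn_integral_mono ennreal_leI) auto
    also have "\<dots> < top" using i by (simp add: integrable_iff_bounded)
    finally show "(\<integral>\<^sup>+x. ennreal (f x) \<partial>M) < top" .
  qed
  \<comment> \<open>Since \<open>ennreal\<close> truncates, \<open>\<phi>\<close> and
    \<open>- \<phi>\<close> yield the positive and the negative part; both integrals are finite, so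
    \<open>enn2real\<close> is additive on them.\<close>
  have "enn2real (\<integral>\<^sup>+x. ennreal (f x) \<partial>add_measure \<mu> \<nu>)
      = enn2real (\<integral>\<^sup>+x. ennreal (f x) \<partial>\<mu>) + enn2real (\<integral>\<^sup>+x. ennreal (f x) \<partial>\<nu>)"
    if "f = \<phi> \<or> f = (\<lambda>x. - \<phi> x)" for f
    using that int(2)[OF \<mu> that] int(2)[OF \<nu> that] \<phi>(1)
    by (subst nn_integral_add_measure[OF s]) (auto simp: enn2real_plus)
  then show ?thesis
    using int(1)[OF \<mu>] int(1)[OF \<nu>] int(1)[OF add_measure_finite[OF \<mu> \<nu>]]
    by (simp add: real_lebesgue_integral_def)
qed

lemma finite_borel_measures_eqI_measure:
  assumes P: "P \<in> finite_borel_measures" and N: "N \<in> finite_borel_measures"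
    and "\<And>A. A \<in> sets borel \<Longrightarrow> measure P A = measure N A"
  shows "P = N"
  using assms by (intro measure_eqI) (auto simp: finite_borel_measures_def finite_measure.emeasure_eq_measure)

lemma measure_add_measure:
  assumes "P \<in> finite_borel_measures" "N \<in> finite_borel_measures" "A \<in> sets borel"
  shows "measure (add_measure P N) A = measure P A + measure N A"
proof -
  have "sets P = sets borel" "sets N = sets borel" "finite_measure P" "finite_measure N"
    using assms by (auto simp: finite_borel_measures_def)
  then have "emeasure (add_measure P N) A = ennreal (measure P A + measure N A)"
    using assms(3) by (simp add: emeasure_add_measure finite_measure.emeasure_eq_measure)
  then show ?thesis by (intro measure_eq_emeasure_eq_ennreal) auto
qed

text \<open>Moving the subtracted measures across turns an identity of signed measures into one of
  positive measures. One direction serves the independence of decompositions, the other the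
  separation of points.\<close>

lemma add_measure_eq_iff_diff_measure_eq:
  assumes "P \<in> finite_borel_measures" "N \<in> finite_borel_measures"
    "P' \<in> finite_borel_measures" "N' \<in> finite_borel_measures"
  shows "add_measure P N' = add_measure N P' \<longleftrightarrow> diff_measure P N = diff_measure P' N'"
proof
  assume eq: "add_measure P N' = add_measure N P'"
  show "diff_measure P N = diff_measure P' N'"
  proof
    fix A :: "'a set"
    show "diff_measure P N A = diff_measure P' N' A"
    proof (cases "A \<in> sets borel")
      case True
      then show ?thesis
        using measure_add_measure[of P N' A] measure_add_measure[of N P' A] eq assms
        by (simp add: diff_measure_def)
    next
      case False
      \<comment> \<open>Off the Borel sets all four measures have the default value 0.\<close>
      then show ?thesis
        using assms by (auto simp: diff_measure_def finite_borel_measures_def measure_notin_sets)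
    qed
  qed
next
  assume eq: "diff_measure P N = diff_measure P' N'"
  show "add_measure P N' = add_measure N P'"
  proof (rule finite_borel_measures_eqI_measure)
    fix A :: "'a set" assume "A \<in> sets borel"
    then show "measure (add_measure P N') A = measure (add_measure N P') A"
      using fun_cong[OF eq, of A] assms by (simp add: measure_add_measure diff_measure_def)
  qed (use assms in \<open>auto intro: add_measure_finite\<close>)
qed

section \<open>Separation by bounded Lipschitz functions\<close>

text \<open>Open sets form an intersection-stable generator. Equality of integrals survives scaling,
  so the Lipschitz constants of the approximations may blow up.\<close>

lemma finite_borel_measures_eqI_test_functions:
  fixes P N :: "'a::euclidean_space measure"
  assumes "0 < a" "0 < b" and P: "P \<in> finite_borel_measures" and N: "N \<in> finite_borel_measures"
    and eq: "\<And>\<phi>. \<phi> \<in> test_functions a b \<Longrightarrow> integral\<^sup>L P \<phi> = integral\<^sup>L N \<phi>"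
  shows "P = N"
proof (rule measure_eqI_generator_eq[where E="{S. open S}" and \<Omega>=UNIV and A="\<lambda>_. UNIV"])
  have s: "sets P = sets borel" "sets N = sets borel" and fin: "finite_measure P" "finite_measure N"
    using P N by (auto simp: finite_borel_measures_def)
  show "Int_stable {S :: 'a set. open S}" by (auto simp: Int_stable_def)
  show "sets P = sigma_sets UNIV {S. open S}" "sets N = sigma_sets UNIV {S. open S}"
    using s by (simp_all add: borel_def)
  show "emeasure P UNIV \<noteq> \<infinity>" using fin(1) by (simp add: finite_measure.emeasure_finite)
  fix U :: "'a set" assume "U \<in> {S. open S}"
  then have U: "open U" by simp
  \<comment> \<open>\<open>infdist\<close> to the empty set is 0, which would give the wrong limit
    for \<open>U = UNIV\<close>.\<close>
  define f where "f n x = (if U = UNIV then 1 else min 1 (real (Suc n) * infdist x (- U)))" for n x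
  have f0: "0 \<le> f n x" "f n x \<le> 1" for n x by (auto simp: f_def infdist_nonneg)
  have lip: "\<bar>f n x - f n y\<bar> \<le> real (Suc n) * dist x y" for n x y
  proof -
    have "\<bar>infdist x (- U) - infdist y (- U)\<bar> \<le> dist x y"
      using infdist_triangle[of x "- U" y] infdist_triangle[of y "- U" x]
      by (simp add: dist_commute abs_le_iff)
    then have "real (Suc n) * \<bar>infdist x (- U) - infdist y (- U)\<bar> \<le> real (Suc n) * dist x y"
      by (rule mult_left_mono) simp
    moreover have "\<bar>real (Suc n) * infdist x (- U) - real (Suc n) * infdist y (- U)\<bar>
        = real (Suc n) * \<bar>infdist x (- U) - infdist y (- U)\<bar>"
      by (simp add: right_diff_distrib[symmetric] abs_mult)
    moreover have "\<bar>min 1 (real (Suc n) * infdist x (- U)) - min 1 (real (Suc n) * infdist y (- U))\<bar>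
        \<le> \<bar>real (Suc n) * infdist x (- U) - real (Suc n) * infdist y (- U)\<bar>"
      by linarith
    ultimately have "\<bar>min 1 (real (Suc n) * infdist x (- U)) - min 1 (real (Suc n) * infdist y (- U))\<bar>
        \<le> real (Suc n) * dist x y" by linarith
    then show ?thesis by (simp add: f_def del: of_nat_Suc)
  qed
  \<comment> \<open>\<open>f n\<close> is bounded by 1 and has Lipschitz constant
    \<open>Suc n\<close>; \<open>t n\<close> scales both down to what \<open>test_functions\<close>
    allows.\<close>
  define t where "t n = min a (b / real (Suc n))" for n
  have t: "0 < t n" "t n \<le> a" "t n * real (Suc n) \<le> b" for n
  proof -
    show "0 < t n" "t n \<le> a" using assms(1,2) by (auto simp: t_def)
    have "t n \<le> b / real (Suc n)" by (simp add: t_def)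
    then show "t n * real (Suc n) \<le> b" by (simp add: pos_le_divide_eq del: of_nat_Suc)
  qed
  have tf: "(\<lambda>x. t n * f n x) \<in> test_functions a b" for n
    unfolding test_functions_def
  proof (intro CollectI conjI allI lipschitz_onI)
    show "\<bar>t n * f n x\<bar> \<le> a" for x
      using mult_mono[of "t n" a "f n x" 1] t[of n] f0[of n x] \<open>0 < a\<close> by simp
    show "dist (t n * f n x) (t n * f n y) \<le> b * dist x y" for x y
    proof -
      have "dist (t n * f n x) (t n * f n y) = t n * \<bar>f n x - f n y\<bar>"
        using t[of n] by (simp add: dist_real_def right_diff_distrib[symmetric] abs_mult)
      also have "\<dots> \<le> t n * (real (Suc n) * dist x y)"
        using t(1)[of n] lip by (intro mult_left_mono) auto
      also have "\<dots> \<le> b * dist x y"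
        using mult_right_mono[OF t(3)[of n], of "dist x y"] by (simp add: mult.assoc)
      finally show ?thesis .
    qed
  qed (use \<open>0 < b\<close> in simp)
  have fm: "f n \<in> borel_measurable borel" for n
  proof -
    have "(\<lambda>x. inverse (t n) * (t n * f n x)) \<in> borel_measurable borel"
      by (rule borel_measurable_const[THEN borel_measurable_times, OF test_functionsD(4)[OF tf]])
    moreover have "(\<lambda>x. inverse (t n) * (t n * f n x)) = f n"
      using t(1)[of n] by (auto simp: mult.assoc[symmetric])
    ultimately show ?thesis by simp
  qed
  have feq: "integral\<^sup>L P (f n) = integral\<^sup>L N (f n)" for n
    using eq[OF tf, of n] t(1)[of n] by simp
  have f_lim: "(\<lambda>n. f n x) \<longlonglongrightarrow> indicator U x" for x
  proof (cases "U = UNIV")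
    case True
    then show ?thesis by (simp add: f_def)
  next
    case False
    then have zero: "infdist y (- U) = 0 \<longleftrightarrow> y \<notin> U" for y
      using in_closed_iff_infdist_zero[of "- U" y] U by auto
    show ?thesis
    proof (cases "x \<in> U")
      case True
      then have pos: "0 < infdist x (- U)"
        using zero[of x] infdist_nonneg[of x "- U"] by linarith
      obtain n0 where n0: "1 < real n0 * infdist x (- U)"
        using reals_Archimedean3[OF pos] by blast
      have "f n x = 1" if "n0 \<le> n" for n
      proof -
        have "real n0 * infdist x (- U) \<le> real (Suc n) * infdist x (- U)"
          using that pos by (intro mult_right_mono) auto
        then show ?thesis using n0 False by (simp add: f_def del: of_nat_Suc)
      qed
      then have "\<forall>\<^sub>F n in sequentially. f n x = 1"
        unfolding eventually_sequentially by blast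
      then show ?thesis using True by (simp add: tendsto_eventually)
    next
      case nU: False
      then show ?thesis using False zero[of x] by (simp add: f_def)
    qed
  qed
  have lim: "(\<lambda>n. integral\<^sup>L M (f n)) \<longlonglongrightarrow> measure M U" if M: "M \<in> finite_borel_measures" for M
  proof -
    have sM: "sets M = sets borel" using M by (simp add: finite_borel_measures_def)
    have "(\<lambda>n. integral\<^sup>L M (f n)) \<longlonglongrightarrow> integral\<^sup>L M (indicator U)"
    proof (rule integral_dominated_convergence)
      show "integrable M (\<lambda>_. 1 :: real)"
        by (rule integrable_bounded_borel[OF M, where a=1]) auto
      show "indicator U \<in> borel_measurable M" "\<And>n. f n \<in> borel_measurable M"
        using fm U measurable_finite_borel_measures[OF M] by auto
    qed (use f_lim f0 in auto)
    then show ?thesis using U by (simp add: sM)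
  qed
  have "measure P U = measure N U"
    using LIMSEQ_unique[OF lim[OF P] lim[OF N, folded feq]] .
  then show "emeasure P U = emeasure N U"
    using fin by (simp add: finite_measure.emeasure_eq_measure)
qed auto

text \<open>
  The choice of the decomposition is immaterial for test functions, by \<open>pairing_eq\<close>.
\<close>

definition pairing :: "('a::euclidean_space \<Rightarrow> real) \<Rightarrow> ('a set \<Rightarrow> real) \<Rightarrow> real" where
  "pairing \<phi> \<mu> = (let (P, N) = (SOME (P, N). decomposes P N \<mu>) in integral\<^sup>L P \<phi> - integral\<^sup>L N \<phi>)"

text \<open>Two decompositions satisfy \<open>add_measure P N' = add_measure N P'\<close>;
  integrating \<open>\<phi>\<close> against both sides and rearranging gives the claim.\<close>

lemma pairing_eq:
  assumes "decomposes P N \<mu>" and \<phi>: "\<phi> \<in> test_functions a b"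
  shows "pairing \<phi> \<mu> = integral\<^sup>L P \<phi> - integral\<^sup>L N \<phi>"
proof -
  obtain P' N' where S: "(SOME (P, N). decomposes P N \<mu>) = (P', N')" by fastforce
  have D': "decomposes P' N' \<mu>"
    using someI[of "\<lambda>(P, N). decomposes P N \<mu>" "(P, N)"] assms(1) S by simp
  have fin: "P \<in> finite_borel_measures" "N \<in> finite_borel_measures"
    "P' \<in> finite_borel_measures" "N' \<in> finite_borel_measures"
    and eq: "diff_measure P N = diff_measure P' N'"
    using assms(1) D' by (auto simp: decomposes_def)
  have "add_measure P N' = add_measure N P'"
    using add_measure_eq_iff_diff_measure_eq[OF fin] eq by simp
  then have "integral\<^sup>L P \<phi> + integral\<^sup>L N' \<phi> = integral\<^sup>L N \<phi> + integral\<^sup>L P' \<phi>"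
    using integral_add_measure[OF fin(1,4) test_functionsD(4,1)[OF \<phi>]]
      integral_add_measure[OF fin(2,3) test_functionsD(4,1)[OF \<phi>]] by simp
  then show ?thesis by (simp add: pairing_def S)
qed

text \<open>The right side mentions no decomposition, so this is the well-definedness of
  \<open>signed_W1\<close>.\<close>

lemma gen_W1_add_measure:
  assumes "0 < a" "0 < b" "decomposes \<mu>P \<mu>N \<mu>" "decomposes \<nu>P \<nu>N \<nu>"
  shows "gen_W1 a b (add_measure \<mu>P \<nu>N) (add_measure \<mu>N \<nu>P)
    = (SUP \<phi>\<in>test_functions a b. ennreal (pairing \<phi> \<mu> - pairing \<phi> \<nu>))"
proof -
  have fin: "\<mu>P \<in> finite_borel_measures" "\<mu>N \<in> finite_borel_measures"
    "\<nu>P \<in> finite_borel_measures" "\<nu>N \<in> finite_borel_measures"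
    using assms by (auto simp: decomposes_def)
  have "integral\<^sup>L (add_measure \<mu>P \<nu>N) \<phi> - integral\<^sup>L (add_measure \<mu>N \<nu>P) \<phi> = pairing \<phi> \<mu> - pairing \<phi> \<nu>"
    if \<phi>: "\<phi> \<in> test_functions a b" for \<phi>
    using integral_add_measure[OF fin(1,4) test_functionsD(4,1)[OF \<phi>]]
      integral_add_measure[OF fin(2,3) test_functionsD(4,1)[OF \<phi>]]
      pairing_eq[OF assms(3) \<phi>] pairing_eq[OF assms(4) \<phi>] by simp
  then show ?thesis
    using fin by (simp add: gen_W1_duality[OF assms(1,2)] add_measure_finite)
qed

lemma signed_measures_iff: "\<mu> \<in> signed_measures \<longleftrightarrow> (\<exists>P N. decomposes P N \<mu>)"
  by (auto simp: signed_measures_def decomposes_def)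

lemma ennreal_signed_W1:
  assumes "0 < a" "0 < b" "\<mu> \<in> signed_measures" "\<nu> \<in> signed_measures"
  shows "ennreal (signed_W1 a b \<mu> \<nu>) = (SUP \<phi>\<in>test_functions a b. ennreal (pairing \<phi> \<mu> - pairing \<phi> \<nu>))"
    (is "_ = ?S")
proof -
  obtain \<mu>P \<mu>N \<nu>P \<nu>N where d: "decomposes \<mu>P \<mu>N \<mu>" "decomposes \<nu>P \<nu>N \<nu>"
    using assms(3,4) signed_measures_iff by metis
  note g = gen_W1_add_measure[OF assms(1,2)]
  \<comment> \<open>At least one pair of decompositions exists; without one every \<open>r\<close>
    would satisfy the description.\<close>
  have "(THE r. \<forall>\<mu>\<^sub>P \<mu>\<^sub>N \<nu>\<^sub>P \<nu>\<^sub>N. decomposes \<mu>\<^sub>P \<mu>\<^sub>N \<mu> \<longrightarrow> decomposes \<nu>\<^sub>P \<nu>\<^sub>N \<nu> \<longrightarrow>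
       r = gen_W1 a b (add_measure \<mu>\<^sub>P \<nu>\<^sub>N) (add_measure \<mu>\<^sub>N \<nu>\<^sub>P)) = ?S"
    using d by (intro the_equality) (auto simp: g)
  moreover have "?S < \<infinity>"
    unfolding g[OF d, symmetric]
    using d by (intro gen_W1_finite add_measure_finite) (auto simp: decomposes_def)
  ultimately show ?thesis by (simp add: signed_W1_def)
qed

section \<open>Metric axioms\<close>

text \<open>Replacing \<open>\<phi>\<close> by \<open>- \<phi>\<close> exchanges the arguments.
  \<open>Metric_space\<close> asks for symmetry outside the carrier too, which is the second
  case.\<close>

lemma signed_W1_commute:
  assumes "0 < a" "0 < b"
  shows "signed_W1 a b \<mu> \<nu> = signed_W1 a b \<nu> \<mu>"
proof (cases "\<mu> \<in> signed_measures \<and> \<nu> \<in> signed_measures")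
  case True
  have le: "ennreal (signed_W1 a b \<mu> \<nu>) \<le> ennreal (signed_W1 a b \<nu> \<mu>)"
    if in_signed: "\<mu> \<in> signed_measures" "\<nu> \<in> signed_measures" for \<mu> \<nu> :: "'a set \<Rightarrow> real"
  proof -
    obtain \<mu>P \<mu>N \<nu>P \<nu>N where d: "decomposes \<mu>P \<mu>N \<mu>" "decomposes \<nu>P \<nu>N \<nu>"
      using in_signed signed_measures_iff by metis
    show ?thesis
      unfolding ennreal_signed_W1[OF assms in_signed] ennreal_signed_W1[OF assms in_signed(2,1)]
    proof (rule SUP_least)
      fix \<phi> :: "'a \<Rightarrow> real" assume \<phi>: "\<phi> \<in> test_functions a b"
      note \<phi>' = uminus_test_functions[OF \<phi>]
      have "pairing \<phi> \<mu> - pairing \<phi> \<nu> = pairing (\<lambda>x. - \<phi> x) \<nu> - pairing (\<lambda>x. - \<phi> x) \<mu>"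
        by (simp add: pairing_eq[OF d(1) \<phi>] pairing_eq[OF d(2) \<phi>] pairing_eq[OF d(1) \<phi>'] pairing_eq[OF d(2) \<phi>'])
      then show "ennreal (pairing \<phi> \<mu> - pairing \<phi> \<nu>)
        \<le> (SUP \<phi>\<in>test_functions a b. ennreal (pairing \<phi> \<nu> - pairing \<phi> \<mu>))"
        using \<phi>' by (intro SUP_upper2) auto
    qed
  qed
  have "ennreal (signed_W1 a b \<mu> \<nu>) = ennreal (signed_W1 a b \<nu> \<mu>)"
    using le True by (intro antisym) auto
  then show ?thesis by (simp add: signed_W1_def)
next
  case False
  \<comment> \<open>The condition on \<open>r\<close> is vacuous in either order, so both
    descriptions denote the same unspecified value.\<close>
  then have "\<not> (decomposes P N \<mu> \<and> decomposes P' N' \<nu>)" for P N P' N'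
    by (auto simp: signed_measures_iff)
  then show ?thesis unfolding signed_W1_def by metis
qed

text \<open>Vanishing of the supremum gives only an inequality of pairings; \<open>- \<phi>\<close>
  gives its converse. Separation is then applied to the positive measures obtained by moving terms
  across.\<close>

lemma signed_W1_eq_0_iff:
  assumes "0 < a" "0 < b" "\<mu> \<in> signed_measures" "\<nu> \<in> signed_measures"
  shows "signed_W1 a b \<mu> \<nu> = 0 \<longleftrightarrow> \<mu> = \<nu>"
proof
  assume "\<mu> = \<nu>"
  moreover have "0 \<le> signed_W1 a b \<mu> \<nu>" by (simp add: signed_W1_def)
  ultimately show "signed_W1 a b \<mu> \<nu> = 0"
    using ennreal_signed_W1[OF assms] by (simp add: SUP_constant bot_ennreal split: if_splits)
next
  assume 0: "signed_W1 a b \<mu> \<nu> = 0"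
  obtain \<mu>P \<mu>N \<nu>P \<nu>N where d: "decomposes \<mu>P \<mu>N \<mu>" "decomposes \<nu>P \<nu>N \<nu>"
    using assms(3,4) signed_measures_iff by metis
  then have fin: "\<mu>P \<in> finite_borel_measures" "\<mu>N \<in> finite_borel_measures"
    "\<nu>P \<in> finite_borel_measures" "\<nu>N \<in> finite_borel_measures"
    and \<mu>\<nu>: "\<mu> = diff_measure \<mu>P \<mu>N" "\<nu> = diff_measure \<nu>P \<nu>N"
    by (auto simp: decomposes_def)
  have le: "pairing \<phi> \<mu> \<le> pairing \<phi> \<nu>" if "\<phi> \<in> test_functions a b" for \<phi>
  proof -
    have "ennreal (pairing \<phi> \<mu> - pairing \<phi> \<nu>) \<le> ennreal (signed_W1 a b \<mu> \<nu>)"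
      unfolding ennreal_signed_W1[OF assms] using that by (rule SUP_upper)
    then show ?thesis by (simp add: 0 ennreal_eq_0_iff)
  qed
  have "add_measure \<mu>P \<nu>N = add_measure \<mu>N \<nu>P"
  proof (rule finite_borel_measures_eqI_test_functions[OF assms(1,2)])
    fix \<phi> :: "'a \<Rightarrow> real" assume \<phi>: "\<phi> \<in> test_functions a b"
    note \<phi>' = uminus_test_functions[OF \<phi>]
    have "pairing \<phi> \<mu> = pairing \<phi> \<nu>"
      using le[OF \<phi>] le[OF \<phi>']
      by (simp add: pairing_eq[OF d(1) \<phi>] pairing_eq[OF d(2) \<phi>] pairing_eq[OF d(1) \<phi>'] pairing_eq[OF d(2) \<phi>'])
    then show "integral\<^sup>L (add_measure \<mu>P \<nu>N) \<phi> = integral\<^sup>L (add_measure \<mu>N \<nu>P) \<phi>"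
      using integral_add_measure[OF fin(1,4) test_functionsD(4,1)[OF \<phi>]]
        integral_add_measure[OF fin(2,3) test_functionsD(4,1)[OF \<phi>]]
      by (simp add: pairing_eq[OF d(1) \<phi>] pairing_eq[OF d(2) \<phi>])
  qed (use fin in \<open>auto intro: add_measure_finite\<close>)
  then show "\<mu> = \<nu>"
    unfolding \<mu>\<nu> using add_measure_eq_iff_diff_measure_eq[OF fin] by simp
qed

text \<open>The inequality holds for each test function separately, by subadditivity of truncation,
  and passes to the supremum.\<close>

lemma signed_W1_triangle:
  assumes "0 < a" "0 < b" "\<mu> \<in> signed_measures" "\<nu> \<in> signed_measures" "\<rho> \<in> signed_measures"
  shows "signed_W1 a b \<mu> \<rho> \<le> signed_W1 a b \<mu> \<nu> + signed_W1 a b \<nu> \<rho>"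
proof -
  have nonneg: "0 \<le> signed_W1 a b \<mu> \<nu>" for \<mu> \<nu> :: "'a set \<Rightarrow> real" by (simp add: signed_W1_def)
  note W = ennreal_signed_W1[OF assms(1,2)]
  have "ennreal (signed_W1 a b \<mu> \<rho>) \<le> ennreal (signed_W1 a b \<mu> \<nu>) + ennreal (signed_W1 a b \<nu> \<rho>)"
    unfolding W[OF assms(3,5)]
  proof (rule SUP_least)
    fix \<phi> :: "'a \<Rightarrow> real" assume \<phi>: "\<phi> \<in> test_functions a b"
    have "ennreal (pairing \<phi> \<mu> - pairing \<phi> \<rho>)
        \<le> ennreal (pairing \<phi> \<mu> - pairing \<phi> \<nu>) + ennreal (pairing \<phi> \<nu> - pairing \<phi> \<rho>)"
      using ennreal_add_le[of "pairing \<phi> \<mu> - pairing \<phi> \<nu>" "pairing \<phi> \<nu> - pairing \<phi> \<rho>"] by simp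
    also have "\<dots> \<le> ennreal (signed_W1 a b \<mu> \<nu>) + ennreal (signed_W1 a b \<nu> \<rho>)"
      unfolding W[OF assms(3,4)] W[OF assms(4,5)] using \<phi> by (intro add_mono SUP_upper)
    finally show "ennreal (pairing \<phi> \<mu> - pairing \<phi> \<rho>) \<le> \<dots>" .
  qed
  then show ?thesis
    using nonneg by (simp flip: ennreal_plus)
qed

theorem proposition17:
  fixes a b :: real
  assumes "a > 0" and "b > 0"
  shows "Metric_space (signed_measures :: ('a::euclidean_space set \<Rightarrow> real) set) (signed_W1 a b)"
proof
  show "0 \<le> signed_W1 a b \<mu> \<nu>" for \<mu> \<nu> :: "'a set \<Rightarrow> real"
    by (simp add: signed_W1_def)
  show "signed_W1 a b \<mu> \<nu> = signed_W1 a b \<nu> \<mu>" for \<mu> \<nu> :: "'a set \<Rightarrow> real"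
    by (rule signed_W1_commute[OF assms])
qed (fact signed_W1_eq_0_iff[OF assms] signed_W1_triangle[OF assms])+

end
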